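(* Fix $x^{(1)},\dots,x^{(n)} \in \mathbb{R}^d$, $b\in\mathbb{R}^d$, and $\lambda>0$, and consider the functions $\mathcal{L}(W,b,\lambda)$ and $\mathcal{L}_{sep}(W,b,\lambda)$ of $W \in \mathbb{R}^{d\times\kappa}$ defined in the context. Let $R\in\mathbb{R}^{\kappa\times\kappa}$ denote an arbitrary rotation matrix and $P\in\mathbb{R}^{\kappa\times\kappa}$ an arbitrary permutation matrix. Let $W^*$ be a (global) minimum of $\mathcal{L}(\cdot,b,\lambda)$ and let $W^{**}$ be any (global) minimum of $\mathcal{L}_{sep}(\cdot,b,\lambda)$. Then the following three properties hold: 1. $\mathcal{L}(W^*,b,\lambda) = \mathcal{L}(W^*R,b,\lambda) = \mathcal{L}_{sep}(W^{**},b,\lambda) = \mathcal{L}(W^{**}P,b,\lambda) = \mathcal{L}_{sep}(W^{**}P,b,\lambda)$. 2. For any $W^{**}(W^{**})^{\top}$ with distinct nonzero eigenvalues, there will exist at least $\frac{\kappa!}{(\kappa-r)!}$ distinct (disconnected) minima of $\mathcal{L}_{sep}(\cdot,b,\lambda)$ located at some $U\Lambda P$ with $P$ a permutation matrix, where $U\Lambda^2U^{\top}$ represents the SVD of $W^{**}(W^{**})^{\top}$ and $r = \mathrm{rank}[W^{**}]$. 3. $W^{**}$ will have at most $r$ nonzero columns, while $W^*$ can have any number of nonzero columns in $\{r,\ldots,\kappa\}$ (i.e., for each $m\in\{r,\ldots,\kappa\}$ there is a minimum $W^*$ of $\mathcal{L}(\cdot,b,\lambda)$ with exactly $m$ nonzero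 columns).
   Context: For $W\in\mathbb{R}^{d\times\kappa}$ with columns $w_{\cdot 1},\dots,w_{\cdot\kappa}$, define $$\mathcal{L}(W,b,\lambda) = \sum_{i=1}^n \left(x^{(i)}-b\right)^{\top}\left(\lambda I + WW^{\top}\right)^{-1}\left(x^{(i)}-b\right) + n\log\left|\lambda I + WW^{\top}\right|,$$ $$\mathcal{L}_{sep}(W,b,\lambda) = \sum_{i=1}^n \left(x^{(i)}-b\right)^{\top}\left(\lambda I + WW^{\top}\right)^{-1}\left(x^{(i)}-b\right) + n\left[\sum_{j=1}^{\kappa}\log\left(\lambda+\|w_{\cdot j}\|_2^2\right) + (d-\kappa)\log\lambda\right].$$ Two minima are called disconnected if, to traverse (along a continuous path) from one to the other, the objective function must ascend at some point along the way. In the SVD notation, $\Lambda$ is the (rectangular, if necessary) nonnegative diagonal matrix of singular values of $W^{**}$, $U$ is the matrix of left singular vectors (orthonormal columns), dimensions being such that $U\Lambda\in\mathbb{R}^{d\times\kappa}$, and $\Lambda^2$ is read as $\Lambda\Lambda^{\top}$.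
   Formalization: In part 3, when r = 0 the claim on the number of nonzero columns of W* is stated only for m = 0, because then W = 0 is the only minimum of L (for example, when all x^(i) = b) and the printed claim fails for every m ≥ 1. *)

theory Defs
  imports "HOL-Analysis.Analysis" "HOL-Computational_Algebra.Polynomial"
begin

text \<open>
  A \<open>d \<times> \<kappa>\<close> matrix \<open>W\<close> has type \<^typ>\<open>real^'k^'d\<close>, with \<open>d = CARD('d)\<close> and \<open>\<kappa> = CARD('k)\<close>.
  The data points are \<open>x 1, \<dots>, x n\<close>, and \<^term>\<open>mat lam\<close> is \<open>\<lambda>I\<close>.
\<close>

definition quad_term ::
  "nat \<Rightarrow> (nat \<Rightarrow> real^'d) \<Rightarrow> real^'d \<Rightarrow> real \<Rightarrow> real^'k^'d \<Rightarrow> real" where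
  "quad_term n x b lam W =
     (\<Sum>i = 1..n. (x i - b) \<bullet> (matrix_inv (mat lam + W ** transpose W) *v (x i - b)))"

definition loss ::
  "nat \<Rightarrow> (nat \<Rightarrow> real^'d) \<Rightarrow> real^'d \<Rightarrow> real \<Rightarrow> real^'k^'d \<Rightarrow> real" where
  "loss n x b lam W =
     quad_term n x b lam W + real n * ln (det (mat lam + W ** transpose W))"

text \<open>The factor \<open>d - \<kappa>\<close> is a real difference; it is negative if \<open>\<kappa> > d\<close>.\<close>

definition loss_sep ::
  "nat \<Rightarrow> (nat \<Rightarrow> real^'d) \<Rightarrow> real^'d \<Rightarrow> real \<Rightarrow> real^'k^'d \<Rightarrow> real" where
  "loss_sep n x b lam W =
     quad_term n x b lam W +
     real n * ((\<Sum>j\<in>UNIV. ln (lam + (norm (column j W))\<^sup>2)) +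
               (real CARD('d) - real CARD('k)) * ln lam)"

abbreviation global_min :: "('a \<Rightarrow> real) \<Rightarrow> 'a \<Rightarrow> bool" where
  "global_min f \<equiv> is_arg_min f (\<lambda>_. True)"

definition permutation_matrix :: "real^'n^'n \<Rightarrow> bool" where
  "permutation_matrix P \<longleftrightarrow>
     (\<exists>p. p permutes UNIV \<and> P = (\<chi> i j. if i = p j then 1 else 0))"

definition nonzero_columns :: "real^'k^'d \<Rightarrow> nat" where
  "nonzero_columns W = card {j. column j W \<noteq> 0}"

text \<open>
  Row and column indices of a rectangular matrix live in different types, so the main diagonal
  consists of the entries whose row and column index have the same position \<open>card {..<i}\<close> in the
  respective order. The diagonal entries are not required to be sorted.
\<close>

definition rectangular_diagonal :: "real^'k::{finite,linorder}^'d::{finite,linorder} \<Rightarrow> bool" where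
  "rectangular_diagonal A \<longleftrightarrow> (\<forall>i j. card {..<i} \<noteq> card {..<j} \<longrightarrow> A $ i $ j = 0)"

text \<open>Full singular value decomposition \<open>W = U S V\<^sup>T\<close>; then \<open>W W\<^sup>T = U (S S\<^sup>T) U\<^sup>T\<close>.\<close>

definition is_svd ::
  "real^'k::{finite,linorder}^'d::{finite,linorder} \<Rightarrow>
   real^'d::{finite,linorder}^'d::{finite,linorder} \<Rightarrow>
   real^'k::{finite,linorder}^'d::{finite,linorder} \<Rightarrow>
   real^'k::{finite,linorder}^'k::{finite,linorder} \<Rightarrow> bool" where
  "is_svd W U S V \<longleftrightarrow>
     orthogonal_matrix U \<and> orthogonal_matrix V \<and>
     rectangular_diagonal S \<and> (\<forall>i j. 0 \<le> S $ i $ j) \<and>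
     W = U ** S ** transpose V"

definition charpoly :: "real^'n^'n \<Rightarrow> real poly" where
  "charpoly A = det (mat [:0, 1:] - (\<chi> i j. [:A $ i $ j:]))"

text \<open>
  No nonzero eigenvalue is repeated: each has algebraic multiplicity one. The eigenvalue zero may
  have any multiplicity. (Only used for symmetric matrices, whose eigenvalues are all real.)
\<close>

definition distinct_nonzero_eigenvalues :: "real^'n^'n \<Rightarrow> bool" where
  "distinct_nonzero_eigenvalues A \<longleftrightarrow> (\<forall>\<mu>. \<mu> \<noteq> 0 \<longrightarrow> order \<mu> (charpoly A) \<le> 1)"

definition disconnected :: "('a::topological_space \<Rightarrow> real) \<Rightarrow> 'a \<Rightarrow> 'a \<Rightarrow> bool" where
  "disconnected f A B \<longleftrightarrow>
     (\<forall>g. path g \<and> pathstart g = A \<and> pathfinish g = B \<longrightarrow>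
        (\<exists>s t. 0 \<le> s \<and> s < t \<and> t \<le> 1 \<and> f (g s) < f (g t)))"

end

theory Submission
  imports Defs
begin

text \<open>
  Adding the columns of \<open>W\<close> one at a time, the matrix determinant lemma gives
  \<open>|\<lambda>I + W W\<^sup>T| \<le> \<lambda>\<^sup>d \<Prod>\<^sub>j (1 + \<parallel>w\<^sub>j\<parallel>\<^sup>2/\<lambda>)\<close>, with equality iff the columns are orthogonal. Hence
  \<open>\<L> \<le> \<L>\<^sub>s\<^sub>e\<^sub>p\<close>, with equality exactly at matrices with orthogonal columns. As \<open>\<L>\<close> depends only on
  \<open>W W\<^sup>T\<close>, and every \<open>W W\<^sup>T\<close> equals \<open>X X\<^sup>T\<close> for some \<open>X\<close> with orthogonal columns, both functions have
  the same minimum and every minimiser of \<open>\<L>\<^sub>s\<^sub>e\<^sub>p\<close> has orthogonal columns.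

  For disconnectedness, stationarity shows that a nonzero column \<open>w\<close> of a minimiser of \<open>\<L>\<^sub>s\<^sub>e\<^sub>p\<close> is an
  eigenvector of the scatter matrix for the eigenvalue \<open>n (\<lambda> + \<parallel>w\<parallel>\<^sup>2)\<close>. So column norms of minimisers
  take finitely many values and are constant along any path on which \<open>\<L>\<^sub>s\<^sub>e\<^sub>p\<close> never ascends, whereas
  distinct eigenvalues make any two different column permutations of \<open>U \<Lambda>\<close> differ in some column norm.
\<close>

subsection \<open>Outer products\<close>

definition outer :: "real^'m \<Rightarrow> real^'n \<Rightarrow> real^'n^'m" where
  "outer v w = (\<chi> i j. v $ i * w $ j)"

lemma outer_mult_vector: "outer v w *v z = (w \<bullet> z) *\<^sub>R v"
  by (simp add: outer_def matrix_vector_mult_def vec_eq_iff inner_vec_def sum_distrib_right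
      sum_distrib_left ac_simps)

lemma transpose_outer_self: "transpose (outer w w) = outer w w"
  by (simp add: outer_def transpose_def vec_eq_iff mult.commute)

lemma matrix_mult_outer: "A ** outer v w = outer (A *v v) w"
  by (simp add: outer_def matrix_matrix_mult_def matrix_vector_mult_def vec_eq_iff
      sum_distrib_left sum_distrib_right ac_simps)

lemma outer_mult_transpose: "outer v w ** transpose B = outer v (B *v w)"
  by (simp add: outer_def matrix_matrix_mult_def matrix_vector_mult_def vec_eq_iff
      transpose_def sum_distrib_left ac_simps)

lemma matrix_add_rdistrib: "(A + B) ** C = A ** C + B ** (C :: real^'n^'m)"
  by (simp add: matrix_matrix_mult_def vec_eq_iff distrib_right sum.distrib)

lemma transpose_add: "transpose (A + B) = transpose A + transpose B"
  by (simp add: transpose_def vec_eq_iff)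

lemma matrix_vector_mult_sum_left:
  fixes A :: "'i \<Rightarrow> real^'n^'m"
  shows "(\<Sum>i\<in>I. A i) *v z = (\<Sum>i\<in>I. A i *v z)"
  by (induction I rule: infinite_finite_induct) (auto simp: matrix_vector_mult_add_rdistrib)

lemma mat_mult_vector: "mat c *v z = c *\<^sub>R (z :: real^'n)"
  by (simp add: mat_def matrix_vector_mult_def vec_eq_iff if_distrib[of "\<lambda>a. a * _"] cong: if_cong)

lemma mult_transpose_eq_sum_outer:
  "W ** transpose W = (\<Sum>j\<in>UNIV. outer (column j W) (column j W))"
  by (simp add: vec_eq_iff matrix_matrix_mult_def outer_def transpose_def column_def)

text \<open>An orthogonal change of basis turns \<open>v\<close> into a multiple of a basis vector.
  The matrix then differs from the identity in a single column, and its determinant can be read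
  off.\<close>

lemma det_mat_1_add_outer: "det (mat 1 + outer u v) = 1 + u \<bullet> (v :: real^'n)"
proof (cases "v = 0")
  case True
  have "outer u 0 = (0 :: real^'n^'n)"
    by (simp add: outer_def vec_eq_iff)
  then show ?thesis
    using True by simp
next
  case False
  fix k :: 'n
  have "norm ((1 / norm v) *\<^sub>R v) = 1"
    using False by simp
  then obtain Q where Q: "orthogonal_matrix Q" and Qk: "Q *v axis k 1 = (1 / norm v) *\<^sub>R v"
    using orthogonal_matrix_exists_basis by metis
  define u' where "u' = transpose Q *v u"
  have v: "v = Q *v (norm v *\<^sub>R axis k 1)"
    using Qk False by (simp add: matrix_vector_mult_scaleR)
  have u: "u = Q *v u'"
    using Q by (simp add: u'_def orthogonal_matrix_def matrix_vector_mul_assoc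
        del: transpose_matrix_vector)
  have QQ: "Q ** transpose Q = mat 1"
    using Q by (simp add: orthogonal_matrix_def)
  have dQ: "det Q * det (transpose Q) = 1"
    by (metis QQ det_mul det_I)
  have "mat 1 + outer u v = Q ** (mat 1 + outer u' (norm v *\<^sub>R axis k 1)) ** transpose Q"
    apply (subst u) apply (subst v)
    by (simp add: matrix_add_ldistrib matrix_add_rdistrib matrix_mult_outer outer_mult_transpose QQ)
  then have "det (mat 1 + outer u v) = det (mat 1 + outer u' (norm v *\<^sub>R axis k 1))"
    using dQ by (simp add: det_mul mult.commute mult.left_commute)
  \<comment> \<open>Only column \<open>k\<close> deviates from the identity, which is the shape that
    Cramer's lemma evaluates.\<close>
  also have "mat 1 + outer u' (norm v *\<^sub>R axis k 1) =
      (\<chi> i j. if j = k then (mat 1 *v (axis k 1 + norm v *\<^sub>R u')) $ i else mat 1 $ i $ j)"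
    unfolding matrix_vector_mul_lid by (auto simp: vec_eq_iff outer_def mat_def axis_def)
  also have "det \<dots> = 1 + norm v * u' $ k"
    unfolding cramer_lemma by (simp add: axis_def)
  also have "norm v * u' $ k = u' \<bullet> (norm v *\<^sub>R axis k 1)"
    by (simp add: inner_axis)
  also have "\<dots> = u \<bullet> v"
    by (subst v, unfold u'_def)
       (simp only: transpose_matrix_vector dot_lmul_matrix)
  finally show ?thesis .
qed

subsection \<open>Rank-one updates of coercive matrices\<close>

text \<open>Symmetric matrices above \<lambda>I in the Loewner order. This is the property of
  \<lambda>I that survives every update by some \<open>outer w w\<close> and bounds the inverse by
  1/\<lambda>.\<close>

definition coercive :: "real \<Rightarrow> real^'n^'n \<Rightarrow> bool" where
  "coercive lam A \<longleftrightarrow> 0 < lam \<and> transpose A = A \<and> (\<forall>z. lam * (z \<bullet> z) \<le> z \<bullet> (A *v z))"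

context
  fixes lam :: real and A :: "real^'n^'n"
  assumes A: "coercive lam A"
begin

lemma coercive_invertible: "invertible A"
proof -
  have "x = 0" if "A *v x = 0" for x
  proof -
    have "lam * (x \<bullet> x) \<le> 0" "0 < lam"
      using A that unfolding coercive_def by (metis inner_zero_right, blast)
    then have "x \<bullet> x \<le> 0"
      by (simp add: mult_le_0_iff)
    then show ?thesis
      using inner_ge_zero[of x] by (metis inner_eq_zero_iff order_antisym)
  qed
  then show ?thesis
    using matrix_left_invertible_ker[of A] invertible_left_inverse[of A] by blast
qed

lemma coercive_inv_mult: "A ** matrix_inv A = mat 1 \<and> matrix_inv A ** A = mat 1"
  using coercive_invertible unfolding invertible_def matrix_inv_def by (rule someI_ex)

lemma coercive_inv_right: "A *v (matrix_inv A *v y) = y"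
  using coercive_inv_mult
  by (simp add: matrix_vector_mul_assoc)

lemma coercive_inv_left: "matrix_inv A *v (A *v y) = y"
  using coercive_inv_mult
  by (simp add: matrix_vector_mul_assoc)

lemma coercive_self_adjoint: "(A *v x) \<bullet> y = x \<bullet> (A *v y)"
  using A unfolding coercive_def by (metis dot_lmul_matrix transpose_matrix_vector)

lemma coercive_inv_self_adjoint: "(matrix_inv A *v x) \<bullet> y = x \<bullet> (matrix_inv A *v y)"
  using coercive_self_adjoint[of "matrix_inv A *v x" "matrix_inv A *v y"]
  by (simp add: coercive_inv_right)

text \<open>With \<open>u\<close> the solution of \<open>A *v u = w\<close>, expand the square and
  use \<open>lam * (u \<bullet> u) \<le> u \<bullet> w\<close>. The squared norm is kept on the left
  because it yields both the upper bound on the inverse form and its equality case.\<close>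

lemma coercive_inv_gap:
  "norm (w - lam *\<^sub>R (matrix_inv A *v w)) ^ 2 \<le> w \<bullet> w - lam * (w \<bullet> (matrix_inv A *v w))"
proof -
  define u where "u = matrix_inv A *v w"
  have w: "A *v u = w"
    by (simp add: u_def coercive_inv_right)
  have "lam * (u \<bullet> u) \<le> u \<bullet> w" and "0 < lam"
    using A w by (auto simp: coercive_def)
  then have "lam * (lam * (u \<bullet> u)) \<le> lam * (u \<bullet> w)"
    by simp
  then show ?thesis
    unfolding u_def[symmetric] power2_norm_eq_inner
    by (simp add: inner_diff_left inner_diff_right inner_commute)
qed

lemma coercive_inv_le: "w \<bullet> (matrix_inv A *v w) \<le> (norm w)\<^sup>2 / lam"
proof -
  have "0 < lam"
    using A by (simp add: coercive_def)
  moreover have "lam * (w \<bullet> (matrix_inv A *v w)) \<le> (norm w)\<^sup>2"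
    using coercive_inv_gap[of w] zero_le_power2[of "norm (w - lam *\<^sub>R (matrix_inv A *v w))"]
    unfolding power2_norm_eq_inner[of w] by linarith
  ultimately show ?thesis
    by (simp add: field_simps)
qed

lemma coercive_inv_eq_iff:
  "w \<bullet> (matrix_inv A *v w) = (norm w)\<^sup>2 / lam \<longleftrightarrow> A *v w = lam *\<^sub>R w"
proof
  have lam: "0 < lam"
    using A by (simp add: coercive_def)
  assume "w \<bullet> (matrix_inv A *v w) = (norm w)\<^sup>2 / lam"
  then have "w \<bullet> w - lam * (w \<bullet> (matrix_inv A *v w)) = 0"
    using lam by (simp add: power2_norm_eq_inner)
  then have "w = lam *\<^sub>R (matrix_inv A *v w)"
    using coercive_inv_gap[of w] by auto
  then have "A *v w = A *v (lam *\<^sub>R (matrix_inv A *v w))"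
    by simp
  then show "A *v w = lam *\<^sub>R w"
    by (simp add: matrix_vector_mult_scaleR coercive_inv_right)
next
  have lam: "0 < lam"
    using A by (simp add: coercive_def)
  assume "A *v w = lam *\<^sub>R w"
  then have "lam *\<^sub>R (matrix_inv A *v w) = w"
    by (metis coercive_inv_left matrix_vector_mult_scaleR)
  then have "lam * (w \<bullet> (matrix_inv A *v w)) = (norm w)\<^sup>2"
    by (metis inner_scaleR_right power2_norm_eq_inner)
  then show "w \<bullet> (matrix_inv A *v w) = (norm w)\<^sup>2 / lam"
    using lam by (simp add: field_simps)
qed

lemma coercive_inv_nonneg: "0 \<le> w \<bullet> (matrix_inv A *v w)"
proof -
  define u where "u = matrix_inv A *v w"
  have "lam * (u \<bullet> u) \<le> u \<bullet> (A *v u)" "0 < lam"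
    using A by (auto simp: coercive_def)
  moreover have "0 \<le> lam * (u \<bullet> u)"
    using \<open>0 < lam\<close> by simp
  ultimately have "0 \<le> u \<bullet> (A *v u)"
    by linarith
  then show ?thesis
    by (simp add: u_def coercive_inv_right inner_commute)
qed

text \<open>The matrix determinant lemma: factoring out \<open>A\<close> leaves a rank-one
  perturbation of the identity.\<close>

lemma det_add_outer: "det (A + outer w w) = det A * (1 + w \<bullet> (matrix_inv A *v w))"
proof -
  have "A ** (mat 1 + outer (matrix_inv A *v w) w) = A + outer w w"
    by (simp add: matrix_add_ldistrib matrix_mult_outer coercive_inv_right)
  then show ?thesis
    by (metis det_mul det_mat_1_add_outer inner_commute)
qed

lemma coercive_add_outer: "coercive lam (A + outer w w)"
proof -
  have "lam * (z \<bullet> z) \<le> z \<bullet> (A *v z) + (w \<bullet> z) * (w \<bullet> z)" for z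
    using A unfolding coercive_def by (smt (verit) zero_le_square)
  then show ?thesis
    using A by (simp add: coercive_def transpose_add transpose_outer_self
      matrix_vector_mult_add_rdistrib outer_mult_vector inner_add_right inner_commute)
qed

end

text \<open>The Sherman-Morrison formula as a quadratic form: the vector \<open>z\<close> is checked
  to solve the updated system. It makes the dependence of the quadratic loss term on one column
  explicit.\<close>

lemma sherman_morrison_quadratic:
  assumes "coercive lam A"
  shows "y \<bullet> (matrix_inv (A + outer w w) *v y) =
    y \<bullet> (matrix_inv A *v y) - (w \<bullet> (matrix_inv A *v y))\<^sup>2 / (1 + w \<bullet> (matrix_inv A *v w))"
proof -
  let ?C = "matrix_inv A"
  define D where "D = 1 + w \<bullet> (?C *v w)"
  define z where "z = ?C *v y - (w \<bullet> (?C *v y) / D) *\<^sub>R (?C *v w)"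
  have D: "D > 0"
    using coercive_inv_nonneg[OF assms, of w] by (simp add: D_def)
  have wz: "w \<bullet> z = w \<bullet> (?C *v y) / D"
  proof -
    have "w \<bullet> z = w \<bullet> (?C *v y) - w \<bullet> (?C *v y) / D * (D - 1)"
      by (simp add: z_def D_def inner_diff_right)
    then show ?thesis
      using D by (simp add: field_simps)
  qed
  have "(A + outer w w) *v z = y"
    by (simp add: matrix_vector_mult_add_rdistrib outer_mult_vector wz)
       (simp add: z_def matrix_vector_mult_diff_distrib matrix_vector_mult_scaleR
         coercive_inv_right[OF assms])
  then have "matrix_inv (A + outer w w) *v y = z"
    by (metis coercive_inv_left[OF coercive_add_outer[OF assms]])
  then show ?thesis
    by (simp add: z_def inner_diff_right D_def power2_eq_square)
       (metis coercive_inv_self_adjoint[OF assms] inner_commute)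
qed

subsection \<open>The determinant bound\<close>

definition orthogonal_columns :: "real^'k^'d \<Rightarrow> bool" where
  "orthogonal_columns W \<longleftrightarrow> (\<forall>i j. i \<noteq> j \<longrightarrow> column i W \<bullet> column j W = 0)"

text \<open>Indexed by a set of columns, so that induction over the set adds the columns one at a
  time.\<close>

definition shifted_gram :: "real \<Rightarrow> ('k \<Rightarrow> real^'d) \<Rightarrow> 'k set \<Rightarrow> real^'d^'d" where
  "shifted_gram lam w J = mat lam + (\<Sum>j\<in>J. outer (w j) (w j))"

lemma shifted_gram_insert:
  "finite J \<Longrightarrow> j \<notin> J \<Longrightarrow>
    shifted_gram lam w (insert j J) = shifted_gram lam w J + outer (w j) (w j)"
  by (simp add: shifted_gram_def add_ac)

lemma shifted_gram_mult_vector: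
  "shifted_gram lam w J *v z = lam *\<^sub>R z + (\<Sum>j\<in>J. (w j \<bullet> z) *\<^sub>R w j)"
  by (simp add: shifted_gram_def matrix_vector_mult_add_rdistrib mat_mult_vector
      matrix_vector_mult_sum_left outer_mult_vector)

lemma coercive_shifted_gram:
  assumes "finite J" "0 < lam"
  shows "coercive lam (shifted_gram lam w J)"
  using assms(1)
proof (induction J rule: finite_induct)
  case empty
  then show ?case
    using assms(2) by (simp add: coercive_def shifted_gram_def mat_mult_vector)
next
  case (insert j J)
  then show ?case
    by (simp add: shifted_gram_insert coercive_add_outer)
qed

text \<open>Pairing the eigenvector equation with \<open>z\<close> leaves a vanishing sum of
  squares.\<close>

lemma shifted_gram_eigenvector_iff:
  assumes "finite J"
  shows "shifted_gram lam w J *v z = lam *\<^sub>R z \<longleftrightarrow> (\<forall>j\<in>J. w j \<bullet> z = 0)"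
proof
  assume "shifted_gram lam w J *v z = lam *\<^sub>R z"
  then have "(\<Sum>j\<in>J. (w j \<bullet> z) *\<^sub>R w j) \<bullet> z = 0"
    by (simp add: shifted_gram_mult_vector)
  then have "(\<Sum>j\<in>J. (w j \<bullet> z) * (w j \<bullet> z)) = 0"
    by (simp add: inner_sum_left)
  then show "\<forall>j\<in>J. w j \<bullet> z = 0"
    using assms by (subst (asm) sum_nonneg_eq_0_iff) auto
qed (simp add: shifted_gram_mult_vector)

text \<open>A new column multiplies the determinant by \<open>q\<close> and the bound by
  \<open>q' \<ge> q\<close>, with \<open>q = q'\<close> iff it is orthogonal to the earlier columns.
  Positivity, bound and equality case go through one induction, because equality of the products
  splits into equality of the factors only when these are positive and ordered.\<close>

lemma det_shifted_gram:
  fixes w :: "'k \<Rightarrow> real^'d"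
  assumes "finite J" "0 < lam"
  defines "bnd \<equiv> \<lambda>J. lam ^ CARD('d) * (\<Prod>j\<in>J. 1 + (norm (w j))\<^sup>2 / lam)"
  shows "0 < det (shifted_gram lam w J) \<and> det (shifted_gram lam w J) \<le> bnd J \<and>
    (det (shifted_gram lam w J) = bnd J \<longleftrightarrow> (\<forall>i\<in>J. \<forall>j\<in>J. i \<noteq> j \<longrightarrow> w i \<bullet> w j = 0))"
  using assms(1)
proof (induction J rule: finite_induct)
  case empty
  have "det (mat lam :: real^'d^'d) = lam ^ CARD('d)"
    by (subst det_diagonal) (auto simp: mat_def)
  then show ?case
    using assms(2) by (simp add: shifted_gram_def bnd_def)
next
  case (insert j J)
  let ?A = "shifted_gram lam w J"
  define q where "q = 1 + w j \<bullet> (matrix_inv ?A *v w j)"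
  define q' where "q' = 1 + (norm (w j))\<^sup>2 / lam"
  have A: "coercive lam ?A"
    using insert.hyps assms(2) by (simp add: coercive_shifted_gram)
  have d: "det (shifted_gram lam w (insert j J)) = det ?A * q"
    using insert.hyps by (simp add: shifted_gram_insert det_add_outer[OF A] q_def)
  have b: "bnd (insert j J) = bnd J * q'"
    using insert.hyps by (simp add: bnd_def q'_def)
  have q: "1 \<le> q" "q \<le> q'"
    using coercive_inv_nonneg[OF A] coercive_inv_le[OF A] by (auto simp: q_def q'_def)
  have "q = q' \<longleftrightarrow> (\<forall>i\<in>J. w i \<bullet> w j = 0)"
    using insert.hyps
    by (simp add: q_def q'_def coercive_inv_eq_iff[OF A] shifted_gram_eigenvector_iff)
  moreover have "det ?A * q = bnd J * q' \<longleftrightarrow> det ?A = bnd J \<and> q = q'"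
  proof
    assume eq: "det ?A * q = bnd J * q'"
    show "det ?A = bnd J \<and> q = q'"
    proof (rule ccontr)
      assume "\<not> ?thesis"
      then have "det ?A < bnd J \<or> q < q'"
        using insert.IH q by auto
      then have "det ?A * q < bnd J * q'"
        using insert.IH q mult_less_le_imp_less[of "det ?A" "bnd J" q q']
          mult_le_less_imp_less[of "det ?A" "bnd J" q q'] by auto
      then show False
        using eq by simp
    qed
  qed simp
  moreover have "det ?A * q \<le> bnd J * q'" "0 < det ?A * q"
    using insert.IH q by (auto intro!: mult_mono)
  ultimately show ?case
    unfolding d b using insert.IH insert.hyps by (auto simp: inner_commute)
qed

section \<open>Comparison of the two losses through the determinant bound\<close>

lemma shifted_gram_columns:
  "mat lam + W ** transpose W = shifted_gram lam (\<lambda>j. column j W) UNIV"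
  by (simp add: shifted_gram_def mult_transpose_eq_sum_outer)

text \<open>The separable penalty is the logarithm of the determinant bound: the \<kappa>
  denominators \<open>lam\<close> against the power \<open>lam ^ CARD('d)\<close> leave the
  coefficient d - \<kappa>.\<close>

lemma ln_det_bound:
  fixes W :: "real^'k^'d"
  assumes "0 < lam"
  shows "ln (lam ^ CARD('d) * (\<Prod>j\<in>UNIV. 1 + (norm (column j W))\<^sup>2 / lam)) =
    (\<Sum>j\<in>UNIV. ln (lam + (norm (column j W))\<^sup>2)) + (real CARD('d) - real CARD('k)) * ln lam"
proof -
  have pos: "0 < 1 + (norm (column j W))\<^sup>2 / lam" for j
    using assms by (intro add_pos_nonneg) auto
  have "ln (1 + (norm (column j W))\<^sup>2 / lam) = ln (lam + (norm (column j W))\<^sup>2) - ln lam" for j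
  proof -
    have "1 + (norm (column j W))\<^sup>2 / lam = (lam + (norm (column j W))\<^sup>2) / lam"
      using assms by (simp add: field_simps)
    moreover have "0 < lam + (norm (column j W))\<^sup>2"
      using assms by (intro add_pos_nonneg) auto
    ultimately show ?thesis
      using assms ln_div[of "lam + (norm (column j W))\<^sup>2" lam] by simp
  qed
  then have "(\<Sum>j\<in>UNIV. ln (1 + (norm (column j W))\<^sup>2 / lam)) =
      (\<Sum>j\<in>UNIV. ln (lam + (norm (column j W))\<^sup>2)) - real CARD('k) * ln lam"
    by (simp add: sum_subtractf)
  moreover have "ln (\<Prod>j\<in>UNIV. 1 + (norm (column j W))\<^sup>2 / lam) =
      (\<Sum>j\<in>UNIV. ln (1 + (norm (column j W))\<^sup>2 / lam))"
    by (rule ln_prod) (use pos less_imp_neq in \<open>fastforce+\<close>)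
  moreover have "ln (lam ^ CARD('d) * (\<Prod>j\<in>UNIV. 1 + (norm (column j W))\<^sup>2 / lam)) =
      real CARD('d) * ln lam + ln (\<Prod>j\<in>UNIV. 1 + (norm (column j W))\<^sup>2 / lam)"
    using assms prod_pos[of UNIV "\<lambda>j. 1 + (norm (column j W))\<^sup>2 / lam"] pos
    by (subst ln_mult) (auto simp: ln_realpow dest: less_imp_neq)
  ultimately show ?thesis
    by (simp add: algebra_simps)
qed

lemma loss_le_loss_sep:
  fixes W :: "real^'k^'d"
  shows "0 < lam \<Longrightarrow> loss n x b lam W \<le> loss_sep n x b lam W"
  using det_shifted_gram[of UNIV lam "\<lambda>j. column j W"]
  unfolding loss_def loss_sep_def shifted_gram_columns
  by (subst ln_det_bound[symmetric]) (auto intro!: mult_left_mono)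

lemma loss_eq_loss_sep:
  fixes W :: "real^'k^'d"
  shows "0 < lam \<Longrightarrow> orthogonal_columns W \<Longrightarrow> loss n x b lam W = loss_sep n x b lam W"
  using det_shifted_gram[of UNIV lam "\<lambda>j. column j W"]
  unfolding loss_def loss_sep_def shifted_gram_columns orthogonal_columns_def
  by (subst ln_det_bound[symmetric]) auto

text \<open>As \<open>n\<close> is positive, it cancels and the logarithms agree; injectivity of
  \<open>ln\<close> on positive reals then gives the equality case of the determinant bound.\<close>

lemma orthogonal_columns_if_loss_eq:
  fixes W :: "real^'k^'d"
  assumes "0 < lam" "1 \<le> n" "loss n x b lam W = loss_sep n x b lam W"
  shows "orthogonal_columns W"
proof -
  let ?D = "det (shifted_gram lam (\<lambda>j. column j W) UNIV)"
  let ?E = "lam ^ CARD('d) * (\<Prod>j\<in>UNIV. 1 + (norm (column j W))\<^sup>2 / lam)"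
  have *: "0 < ?D" "?D \<le> ?E"
    "?D = ?E \<longleftrightarrow> (\<forall>i\<in>UNIV. \<forall>j\<in>UNIV. i \<noteq> j \<longrightarrow> column i W \<bullet> column j W = 0)"
    using det_shifted_gram[of UNIV lam "\<lambda>j. column j W"] assms(1) by simp_all
  have "ln ?D = ln ?E"
    using assms(2,3)
    unfolding loss_def loss_sep_def shifted_gram_columns ln_det_bound[OF assms(1), symmetric]
    by simp
  then have "?D = ?E"
    using * by simp
  then show ?thesis
    using * by (simp add: orthogonal_columns_def)
qed

subsection \<open>Orthogonalising the columns\<close>

lemma sum_UNIV_remove2:
  fixes f :: "'k::finite \<Rightarrow> 'a::comm_monoid_add"
  assumes "i \<noteq> j"
  shows "sum f UNIV = f i + f j + sum f (UNIV - {i, j})"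
proof -
  have "sum f UNIV = f i + (f j + sum f (UNIV - {i} - {j}))"
    using assms by (subst sum.remove[of _ i], simp, simp, subst sum.remove[of _ j]) auto
  then show ?thesis
    by (simp add: add.assoc Diff_insert2[symmetric] insert_commute)
qed

lemma mult_transpose_nth: "(X ** transpose X) $ r $ q = (\<Sum>l\<in>UNIV. X $ r $ l * X $ q $ l)"
  by (simp add: matrix_matrix_mult_def transpose_def)

text \<open>The fibre is cut out by polynomial equations, and the trace of \<open>G\<close> fixes
  the Frobenius norm of its elements.\<close>

lemma compact_gram_fibre: "compact {X :: real^'k^'d. X ** transpose X = G}"
proof -
  have "closed {X :: real^'k^'d. \<forall>r q. (\<Sum>l\<in>UNIV. X $ r $ l * X $ q $ l) = G $ r $ q}"
    by (intro closed_Collect_all closed_Collect_eq continuous_intros)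
  then have "closed {X :: real^'k^'d. X ** transpose X = G}"
    by (simp add: vec_eq_iff mult_transpose_nth)
  moreover have "norm X = sqrt (\<Sum>r\<in>UNIV. G $ r $ r)" if "X ** transpose X = G" for X :: "real^'k^'d"
    unfolding that[symmetric] mult_transpose_nth norm_eq_sqrt_inner by (simp add: inner_vec_def)
  then have "bounded {X :: real^'k^'d. X ** transpose X = G}"
    by (intro boundedI[where B = "sqrt (\<Sum>r\<in>UNIV. G $ r $ r)"]) auto
  ultimately show ?thesis
    by (simp add: compact_eq_bounded_closed)
qed

text \<open>\<open>Y\<close> is \<open>X\<close> times a plane rotation in the coordinates
  \<open>i\<close> and \<open>j\<close>, written out entrywise.\<close>

lemma column_rotation:
  fixes X :: "real^'k^'d"
  assumes "i \<noteq> j" "c\<^sup>2 + s\<^sup>2 = 1"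
  defines "Y \<equiv> (\<chi> r l. if l = i then c * X $ r $ i - s * X $ r $ j
                     else if l = j then s * X $ r $ i + c * X $ r $ j else X $ r $ l)"
  shows "Y ** transpose Y = X ** transpose X"
    and "column i Y = c *\<^sub>R column i X - s *\<^sub>R column j X"
    and "column j Y = s *\<^sub>R column i X + c *\<^sub>R column j X"
    and "l \<noteq> i \<Longrightarrow> l \<noteq> j \<Longrightarrow> column l Y = column l X"
proof -
  have "(c * a - s * b) * (c * a' - s * b') + (s * a + c * b) * (s * a' + c * b') = a * a' + b * b'"
    for a b a' b'
  proof -
    have "(c * a - s * b) * (c * a' - s * b') + (s * a + c * b) * (s * a' + c * b') =
        (c\<^sup>2 + s\<^sup>2) * (a * a' + b * b')"
      by (simp add: power2_eq_square algebra_simps)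
    then show ?thesis
      using assms(2) by simp
  qed
  then show "Y ** transpose Y = X ** transpose X"
    using assms(1)
    by (simp add: vec_eq_iff mult_transpose_nth sum_UNIV_remove2[OF assms(1)] Y_def)
qed (use assms(1) in \<open>simp_all add: Y_def column_def vec_eq_iff\<close>)

text \<open>Here \<delta> stands for the difference of the squared norms of two columns and
  \<open>m\<close> for their inner product; the expression in \<open>c\<close> and \<open>s\<close>
  is that difference after rotation. The double angle \<open>t\<close> is chosen in the direction of
  (\<delta>, -2m), so that the new difference is \<open>h\<close>, which exceeds the absolute value
  of \<delta>.\<close>

lemma ex_diagonalising_rotation:
  fixes \<delta> m :: real
  assumes "m \<noteq> 0"
  obtains c s :: real where "c\<^sup>2 + s\<^sup>2 = 1" "((c\<^sup>2 - s\<^sup>2) * \<delta> - 4 * c * s * m)\<^sup>2 > \<delta>\<^sup>2"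
proof -
  define h where "h = sqrt (\<delta>\<^sup>2 + 4 * m\<^sup>2)"
  have h2: "h\<^sup>2 = \<delta>\<^sup>2 + 4 * m\<^sup>2"
    by (simp add: h_def)
  have h: "h > 0"
    using assms by (simp add: h_def add_nonneg_pos)
  have "(\<delta> / h)\<^sup>2 + (- 2 * m / h)\<^sup>2 = 1"
    using h by (simp add: power_divide power_mult_distrib add_divide_distrib[symmetric] h2[symmetric])
  then obtain t where t: "\<delta> / h = cos t" "- 2 * m / h = sin t"
    using sincos_total_2pi by metis
  define c s where "c = cos (t / 2)" and "s = sin (t / 2)"
  have diff: "c\<^sup>2 - s\<^sup>2 = \<delta> / h"
    using cos_double[of "t / 2"] t by (simp add: c_def s_def)
  have prod: "2 * c * s = - 2 * m / h"
    using sin_double[of "t / 2"] t by (simp add: c_def s_def)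
  have "(c\<^sup>2 - s\<^sup>2) * \<delta> - 4 * c * s * m = (c\<^sup>2 - s\<^sup>2) * \<delta> - 2 * (2 * c * s) * m"
    by simp
  also have "\<dots> = h\<^sup>2 / h"
    unfolding diff prod h2 by (simp add: power2_eq_square add_divide_distrib)
  finally have "(c\<^sup>2 - s\<^sup>2) * \<delta> - 4 * c * s * m = h\<^sup>2 / h" .
  then have "((c\<^sup>2 - s\<^sup>2) * \<delta> - 4 * c * s * m)\<^sup>2 = h\<^sup>2"
    by (simp add: power2_eq_square)
  then have "((c\<^sup>2 - s\<^sup>2) * \<delta> - 4 * c * s * m)\<^sup>2 > \<delta>\<^sup>2"
    using h2 assms by simp
  moreover have "c\<^sup>2 + s\<^sup>2 = 1"
    by (simp add: c_def s_def)
  ultimately show ?thesis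
    using that by blast
qed

text \<open>
  Jacobi's argument: on the compact fibre of \<open>X \<mapsto> X X\<^sup>T\<close> maximise the sum of the fourth powers of
  the column norms; a pair of non-orthogonal columns could be rotated to increase that sum.
\<close>

lemma ex_orthogonal_columns_same_gram:
  fixes W :: "real^'k^'d"
  obtains X :: "real^'k^'d" where "X ** transpose X = W ** transpose W" "orthogonal_columns X"
proof -
  define K where "K = {X :: real^'k^'d. X ** transpose X = W ** transpose W}"
  define F where "F X = (\<Sum>l\<in>UNIV. (column l X \<bullet> column l X)\<^sup>2)" for X :: "real^'k^'d"
  have "continuous_on K F"
    unfolding F_def column_def inner_vec_def by (simp, intro continuous_intros)
  moreover have "compact K" "K \<noteq> {}"
    unfolding K_def using compact_gram_fibre by auto
  ultimately obtain X where X: "X \<in> K" and max: "\<And>Y. Y \<in> K \<Longrightarrow> F Y \<le> F X"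
    by (metis continuous_attains_sup)
  have "column i X \<bullet> column j X = 0" if ij: "i \<noteq> j" for i j
  proof (rule ccontr)
    assume m: "column i X \<bullet> column j X \<noteq> 0"
    define \<delta> where "\<delta> = column i X \<bullet> column i X - column j X \<bullet> column j X"
    obtain c s where cs: "c\<^sup>2 + s\<^sup>2 = 1"
      and gt: "((c\<^sup>2 - s\<^sup>2) * \<delta> - 4 * c * s * (column i X \<bullet> column j X))\<^sup>2 > \<delta>\<^sup>2"
      using ex_diagonalising_rotation[OF m] by blast
    define Y where "Y = (\<chi> r l. if l = i then c * X $ r $ i - s * X $ r $ j
                     else if l = j then s * X $ r $ i + c * X $ r $ j else X $ r $ l)"
    note rot = column_rotation[OF ij cs, where X = X, folded Y_def]
    define a b m where "a = column i X \<bullet> column i X" and "b = column j X \<bullet> column j X"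
      and "m = column i X \<bullet> column j X"
    define a' b' where "a' = column i Y \<bullet> column i Y" and "b' = column j Y \<bullet> column j Y"
    have a': "a' = c\<^sup>2 * a + s\<^sup>2 * b - 2 * c * s * m"
      unfolding a'_def rot a_def b_def m_def
      by (simp add: inner_diff_left inner_diff_right inner_commute power2_eq_square algebra_simps)
    have b': "b' = s\<^sup>2 * a + c\<^sup>2 * b + 2 * c * s * m"
      unfolding b'_def rot a_def b_def m_def
      by (simp add: inner_add_left inner_add_right inner_commute power2_eq_square algebra_simps)
    have "a' + b' = (c\<^sup>2 + s\<^sup>2) * (a + b)"
      unfolding a' b' by (simp add: algebra_simps)
    then have sum: "a' + b' = a + b"
      using cs by simp
    have "a' - b' = (c\<^sup>2 - s\<^sup>2) * (a - b) - 4 * c * s * m"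
      unfolding a' b' by (simp add: algebra_simps)
    then have diff: "(a' - b')\<^sup>2 > (a - b)\<^sup>2"
      using gt by (simp add: \<delta>_def a_def b_def m_def)
    \<comment> \<open>The rotation preserves the sum \<open>a + b\<close>, so a larger difference
      forces a larger sum of squares.\<close>
    have "2 * (a'\<^sup>2 + b'\<^sup>2) = (a' + b')\<^sup>2 + (a' - b')\<^sup>2" "2 * (a\<^sup>2 + b\<^sup>2) = (a + b)\<^sup>2 + (a - b)\<^sup>2"
      by (simp_all add: power2_eq_square algebra_simps)
    then have "a'\<^sup>2 + b'\<^sup>2 > a\<^sup>2 + b\<^sup>2"
      using sum diff by simp
    moreover have "(\<Sum>l\<in>UNIV - {i, j}. (column l Y \<bullet> column l Y)\<^sup>2) =
        (\<Sum>l\<in>UNIV - {i, j}. (column l X \<bullet> column l X)\<^sup>2)"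
      by (rule sum.cong) (auto simp: rot(4))
    ultimately have "F Y > F X"
      unfolding F_def sum_UNIV_remove2[OF ij] by (simp add: a'_def b'_def a_def b_def)
    moreover have "Y \<in> K"
      using X rot(1) by (simp add: K_def)
    ultimately show False
      using max by force
  qed
  then have "orthogonal_columns X"
    by (simp add: orthogonal_columns_def)
  then show ?thesis
    using that X by (simp add: K_def)
qed

section \<open>Minima of the two losses\<close>

lemma loss_cong:
  "X ** transpose X = W ** transpose W \<Longrightarrow> loss n x b lam X = loss n x b lam W"
  by (simp add: loss_def quad_term_def)

lemma global_min_iff: "global_min f a \<longleftrightarrow> (\<forall>y. f a \<le> (f y :: real))"
  by (simp add: is_arg_min_linorder)

text \<open>Orthogonalising the columns of any \<open>Y\<close> keeps its loss and makes the two
  losses agree, so the minimum of \<open>loss_sep\<close> lies below every value of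
  \<open>loss\<close>. At \<open>W\<close> itself this meets the inequality
  \<open>loss_le_loss_sep\<close>.\<close>

lemma global_min_loss_sepD:
  fixes W :: "real^'k^'d"
  assumes "0 < lam" "1 \<le> n" "global_min (loss_sep n x b lam) W"
  shows "global_min (loss n x b lam) W" "orthogonal_columns W"
    "loss n x b lam W = loss_sep n x b lam W"
proof -
  have *: "loss_sep n x b lam W \<le> loss n x b lam Y" for Y :: "real^'k^'d"
  proof -
    obtain X :: "real^'k^'d" where "X ** transpose X = Y ** transpose Y" "orthogonal_columns X"
      by (rule ex_orthogonal_columns_same_gram[of Y])
    then have "loss_sep n x b lam X = loss n x b lam Y"
      using loss_eq_loss_sep[OF assms(1), of X n x b] loss_cong[of X Y n x b lam] by simp
    then show ?thesis
      using assms(3) by (metis global_min_iff)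
  qed
  show eq: "loss n x b lam W = loss_sep n x b lam W"
    using *[of W] loss_le_loss_sep[OF assms(1), of n x b W] by simp
  show "global_min (loss n x b lam) W"
    using * by (simp add: global_min_iff eq)
  show "orthogonal_columns W"
    using orthogonal_columns_if_loss_eq[OF assms(1,2) eq] .
qed

lemma loss_sep_same_gram:
  fixes W X :: "real^'k^'d"
  assumes "0 < lam" "1 \<le> n" "global_min (loss_sep n x b lam) W"
    and "X ** transpose X = W ** transpose W" "orthogonal_columns X"
  shows "loss_sep n x b lam X = loss_sep n x b lam W"
  using global_min_loss_sepD(3)[OF assms(1-3)] loss_cong[OF assms(4), of n x b lam]
    loss_eq_loss_sep[OF assms(1,5), of n x b] by simp

subsection \<open>Stationarity and disconnected minima\<close>

text \<open>Eigenvectors for different eigenvalues are orthogonal, so choosing one for each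
  eigenvalue gives an independent set, which is finite in a Euclidean space.\<close>

lemma finite_eigenvalues_self_adjoint:
  fixes T :: "'a::euclidean_space \<Rightarrow> 'a"
  assumes "\<And>u v. T u \<bullet> v = u \<bullet> T v"
  shows "finite {\<theta>. \<exists>v. v \<noteq> 0 \<and> T v = \<theta> *\<^sub>R v}" (is "finite ?E")
proof -
  have "\<forall>\<theta>\<in>?E. \<exists>v. v \<noteq> 0 \<and> T v = \<theta> *\<^sub>R v"
    by simp
  from bchoice[OF this] obtain v where
    "\<forall>\<theta>\<in>?E. v \<theta> \<noteq> 0 \<and> T (v \<theta>) = \<theta> *\<^sub>R v \<theta>" ..
  then have v: "v \<theta> \<noteq> 0 \<and> T (v \<theta>) = \<theta> *\<^sub>R v \<theta>" if "\<theta> \<in> ?E" for \<theta>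
    using that by (rule bspec)
  have orth: "v \<theta> \<bullet> v \<eta> = 0" if "\<theta> \<in> ?E" "\<eta> \<in> ?E" "\<theta> \<noteq> \<eta>" for \<theta> \<eta>
  proof -
    have "\<theta> * (v \<theta> \<bullet> v \<eta>) = \<eta> * (v \<theta> \<bullet> v \<eta>)"
      using assms[of "v \<theta>" "v \<eta>"] v[OF that(1)] v[OF that(2)] by simp
    then show ?thesis
      using that(3) by simp
  qed
  have inj: "inj_on v ?E"
  proof (rule inj_onI, rule ccontr)
    fix \<theta> \<eta> assume "\<theta> \<in> ?E" "\<eta> \<in> ?E" "v \<theta> = v \<eta>" "\<theta> \<noteq> \<eta>"
    then have "v \<theta> = 0"
      using orth[of \<theta> \<eta>] by simp
    then show False
      using v[OF \<open>\<theta> \<in> ?E\<close>] by simp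
  qed
  have "pairwise orthogonal (v ` ?E)"
  proof (rule pairwiseI)
    fix a c assume "a \<in> v ` ?E" "c \<in> v ` ?E" "a \<noteq> c"
    then obtain \<theta> \<eta> where "\<theta> \<in> ?E" "\<eta> \<in> ?E" "\<theta> \<noteq> \<eta>" "a = v \<theta>" "c = v \<eta>"
      by blast
    then show "orthogonal a c"
      unfolding orthogonal_def using orth by simp
  qed
  moreover have "0 \<notin> v ` ?E"
    using v by fastforce
  ultimately have "independent (v ` ?E)"
    by (rule pairwise_orthogonal_independent)
  then have "finite (v ` ?E)"
    by (rule finiteI_independent)
  then show ?thesis
    using inj by (rule finite_imageD)
qed

text \<open>Only column \<open>j\<close> is varied. With the other columns collected in
  \<open>A\<close>, the Sherman-Morrison formula makes the loss an explicit function of that column,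
  whose directional derivatives vanish at \<open>w\<close>. Orthogonality of the columns makes
  \<open>w\<close> an eigenvector of \<open>A\<close> for \<open>lam\<close>, which keeps the
  resulting equations solvable by hand.\<close>

lemma minimiser_column_eigenvector:
  fixes W :: "real^'k^'d" and j :: 'k
  assumes lam: "0 < lam" and n: "1 \<le> n" and min: "global_min (loss_sep n x b lam) W"
  defines "w \<equiv> column j W"
  assumes w0: "w \<noteq> 0"
  shows "(\<Sum>i = 1..n. ((x i - b) \<bullet> w) *\<^sub>R (x i - b)) = (real n * (lam + (norm w)\<^sup>2)) *\<^sub>R w"
proof -
  define y where "y i = x i - b" for i
  define A where "A = shifted_gram lam (\<lambda>l. column l W) (UNIV - {j})"
  define C where "C = matrix_inv A"
  define W' where "W' v = (\<chi> r l. if l = j then v $ r else W $ r $ l)" for v :: "real^'d"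
  have col: "column l (W' v) = (if l = j then v else column l W)" for l v
    by (simp add: W'_def column_def vec_eq_iff)
  have W: "W' w = W"
    by (simp add: W'_def w_def column_def vec_eq_iff)
  have A: "coercive lam A"
    unfolding A_def using lam by (intro coercive_shifted_gram) auto
  have Aw: "A *v w = lam *\<^sub>R w"
    unfolding A_def using global_min_loss_sepD(2)[OF lam n min]
    by (subst shifted_gram_eigenvector_iff) (auto simp: w_def orthogonal_columns_def)
  have "w = lam *\<^sub>R (C *v w)"
    unfolding C_def by (metis coercive_inv_left[OF A] matrix_vector_mult_scaleR Aw)
  then have Cw: "C *v w = (1 / lam) *\<^sub>R w"
    using lam by (metis (no_types, lifting) divide_self_if less_irrefl scaleR_one scaleR_scaleR times_divide_eq_left mult_1)
  have Csym: "(C *v u) \<bullet> v = u \<bullet> (C *v v)" for u v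
    unfolding C_def by (rule coercive_inv_self_adjoint[OF A])
  have gram: "mat lam + W' v ** transpose (W' v) = A + outer v v" for v
  proof -
    have "insert j (UNIV - {j}) = UNIV"
      by auto
    then have "shifted_gram lam (\<lambda>l. column l (W' v)) UNIV =
        shifted_gram lam (\<lambda>l. column l (W' v)) (UNIV - {j}) + outer v v"
      using shifted_gram_insert[of "UNIV - {j}" j lam "\<lambda>l. column l (W' v)"] by (simp add: col)
    also have "shifted_gram lam (\<lambda>l. column l (W' v)) (UNIV - {j}) = A"
      unfolding A_def shifted_gram_def by (simp add: col)
    finally show ?thesis
      by (simp add: shifted_gram_columns)
  qed
  \<comment> \<open>The part of the loss that depends on column \<open>j\<close>; \<open>K\<close>
    collects the rest.\<close>
  define \<phi> where "\<phi> v = real n * ln (lam + v \<bullet> v) -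
    (\<Sum>i = 1..n. (v \<bullet> (C *v y i))\<^sup>2) / (1 + v \<bullet> (C *v v))" for v
  define K where "K = (\<Sum>i = 1..n. y i \<bullet> (C *v y i)) + real n *
    ((\<Sum>l\<in>UNIV - {j}. ln (lam + (norm (column l W))\<^sup>2)) + (real CARD('d) - real CARD('k)) * ln lam)"
  have loss: "loss_sep n x b lam (W' v) = \<phi> v + K" for v
  proof -
    have "quad_term n x b lam (W' v) = (\<Sum>i = 1..n. y i \<bullet> (C *v y i)) -
        (\<Sum>i = 1..n. (v \<bullet> (C *v y i))\<^sup>2) / (1 + v \<bullet> (C *v v))"
      unfolding quad_term_def gram sherman_morrison_quadratic[OF A]
      by (simp add: C_def y_def sum_subtractf sum_divide_distrib)
    moreover have "(\<Sum>l\<in>UNIV. ln (lam + (norm (column l (W' v)))\<^sup>2)) =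
        ln (lam + v \<bullet> v) + (\<Sum>l\<in>UNIV - {j}. ln (lam + (norm (column l W))\<^sup>2))"
      by (subst sum.remove[of _ j]) (auto simp: col power2_norm_eq_inner)
    ultimately show ?thesis
      unfolding loss_sep_def \<phi>_def K_def by (simp add: algebra_simps)
  qed
  have \<phi>_min: "\<phi> w \<le> \<phi> v" for v
    using min loss[of v] loss[of w] unfolding W global_min_iff by (metis add_le_cancel_right)
  define \<alpha> where "\<alpha> = w \<bullet> w"
  define D where "D = 1 + \<alpha> / lam"
  define p where "p i = w \<bullet> (C *v y i)" for i
  have \<alpha>: "\<alpha> > 0"
    using w0 by (simp add: \<alpha>_def)
  have D: "D > 0" "lam + \<alpha> > 0" "D = (lam + \<alpha>) / lam"
    using \<alpha> lam by (auto simp: D_def add_pos_pos field_simps)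
  have deriv: "real n * (2 * (h \<bullet> w)) / (lam + \<alpha>) -
      ((\<Sum>i = 1..n. 2 * p i * (h \<bullet> (C *v y i))) * D -
        (\<Sum>i = 1..n. (p i)\<^sup>2) * (2 * (h \<bullet> w) / lam)) / D\<^sup>2 = 0" for h
  proof -
    define q where "q i = h \<bullet> (C *v y i)" for i
    define \<beta> where "\<beta> = h \<bullet> w"
    \<comment> \<open>The restriction of \<open>\<phi>\<close> to the line through \<open>w\<close>
      in direction \<open>h\<close>, with the quadratic forms expanded in \<open>t\<close>.\<close>
    define f where "f t = real n * ln (lam + \<alpha> + 2 * \<beta> * t + (h \<bullet> h) * t\<^sup>2) -
      (\<Sum>i = 1..n. (p i + q i * t)\<^sup>2) / (D + 2 * \<beta> / lam * t + (h \<bullet> (C *v h)) * t\<^sup>2)" for t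
    have hCw: "h \<bullet> (C *v w) = \<beta> / lam" "w \<bullet> (C *v h) = \<beta> / lam" "w \<bullet> (C *v w) = \<alpha> / lam"
      using Csym[of w h] by (auto simp: Cw \<alpha>_def \<beta>_def inner_commute)
    have f: "f t = \<phi> (w + t *\<^sub>R h)" for t
    proof -
      have "(w + t *\<^sub>R h) \<bullet> (w + t *\<^sub>R h) = \<alpha> + 2 * \<beta> * t + (h \<bullet> h) * t\<^sup>2"
        by (simp add: inner_add_left inner_add_right inner_commute \<alpha>_def \<beta>_def power2_eq_square algebra_simps)
      moreover have "(w + t *\<^sub>R h) \<bullet> (C *v y i) = p i + q i * t" for i
        by (simp add: inner_add_left p_def q_def)
      moreover have "1 + (w + t *\<^sub>R h) \<bullet> (C *v (w + t *\<^sub>R h)) =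
          D + 2 * \<beta> / lam * t + (h \<bullet> (C *v h)) * t\<^sup>2"
        by (simp add: matrix_vector_right_distrib matrix_vector_mult_scaleR
            inner_add_left inner_add_right hCw D_def power2_eq_square algebra_simps)
      ultimately show ?thesis
        by (simp add: f_def \<phi>_def add.assoc)
    qed
    have der: "(f has_real_derivative (real n * (2 * \<beta>) / (lam + \<alpha>) -
        ((\<Sum>i = 1..n. 2 * p i * q i) * D - (\<Sum>i = 1..n. (p i)\<^sup>2) * (2 * \<beta> / lam)) / D\<^sup>2)) (at 0)"
      unfolding f_def using D
      by (auto intro!: derivative_eq_intros simp: power2_eq_square mult_ac)
    \<comment> \<open>The radius 1 is arbitrary, as \<open>w\<close> minimises \<open>\<phi>\<close>
      globally.\<close>
    have "\<forall>t. \<bar>0 - t\<bar> < 1 \<longrightarrow> f 0 \<le> f t"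
      using \<phi>_min by (simp add: f)
    from DERIV_local_min[OF der zero_less_one this] show ?thesis
      unfolding \<beta>_def q_def .
  qed
  define P where "P = (\<Sum>i = 1..n. (p i)\<^sup>2)"
  define N where "N = real n"
  define Q where "Q h = (\<Sum>i = 1..n. p i * (h \<bullet> (C *v y i)))" for h
  have deriv': "N * (h \<bullet> w) / (lam + \<alpha>) = (Q h * D - P * ((h \<bullet> w) / lam)) / D\<^sup>2" for h
  proof -
    have sum: "(\<Sum>i = 1..n. 2 * p i * (h \<bullet> (C *v y i))) = 2 * Q h"
      by (simp add: Q_def sum_distrib_left mult.assoc)
    have alg: "k * (2 * a) / m - (2 * q * d - r * (2 * a / l)) / e = 2 * (k * a / m - (q * d - r * (a / l)) / e)"
      for k a m q d r l e :: real
      by (simp add: diff_divide_distrib right_diff_distrib mult_ac)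
    have "2 * (N * (h \<bullet> w) / (lam + \<alpha>) - (Q h * D - P * ((h \<bullet> w) / lam)) / D\<^sup>2) = 0"
      unfolding alg[symmetric] using deriv[of h] unfolding sum P_def[symmetric] N_def[symmetric] .
    moreover have "a = c" if "2 * (a - c) = 0" for a c :: real
      using that by simp
    ultimately show ?thesis
      by blast
  qed
  \<comment> \<open>In direction \<open>h = w\<close> the condition involves \<open>P\<close> alone,
    because \<open>D - \<alpha> / lam = 1\<close>. Substituting its solution then determines
    \<open>Q h\<close> in every direction.\<close>
  have "Q w = P"
    by (simp add: Q_def P_def p_def power2_eq_square)
  then have "N * \<alpha> / (lam + \<alpha>) = P / D\<^sup>2"
    using deriv'[of w] D(1) by (simp add: \<alpha>_def[symmetric] D_def algebra_simps)
  then have "P = N * \<alpha> / (lam + \<alpha>) * D\<^sup>2"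
    using D(1) by simp
  then have P: "P = N * \<alpha> * (lam + \<alpha>) / lam\<^sup>2"
    unfolding D(3) using D(2) by (simp add: power2_eq_square)
  have Q: "Q h = N * (lam + \<alpha>) / lam\<^sup>2 * (h \<bullet> w)" for h
  proof -
    have "Q h * D = N * (h \<bullet> w) / (lam + \<alpha>) * D\<^sup>2 + P * ((h \<bullet> w) / lam)"
      using deriv'[of h] D(1) by (simp add: field_simps)
    also have "\<dots> = N * (lam + \<alpha>) / lam\<^sup>2 * (h \<bullet> w) * D"
      unfolding P D(3) using lam D(2) by (simp add: divide_simps power2_eq_square) (simp add: algebra_simps)
    finally show ?thesis
      using D(1) by (metis less_irrefl mult_right_cancel)
  qed
  \<comment> \<open>The scatter operator applied to \<open>w\<close>. The formulas for
    \<open>Q h\<close>, valid for all \<open>h\<close>, determine \<open>C *v S\<close>, and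
    multiplication by \<open>A\<close> recovers \<open>S\<close>.\<close>
  define S where "S = (\<Sum>i = 1..n. (y i \<bullet> w) *\<^sub>R y i)"
  have p: "p i = (y i \<bullet> w) / lam" for i
    by (simp add: p_def Csym[symmetric] Cw inner_commute)
  have "Q h = h \<bullet> (C *v S) / lam" for h
    by (simp add: Q_def p S_def Csym[symmetric] inner_sum_right sum_divide_distrib)
  then have "h \<bullet> (C *v S) = h \<bullet> ((N * (lam + \<alpha>) / lam) *\<^sub>R w)" for h
    using Q[of h] lam by (simp add: field_simps power2_eq_square)
  then have "C *v S = (N * (lam + \<alpha>) / lam) *\<^sub>R w"
    by (metis vector_eq_ldot)
  then have "S = A *v ((N * (lam + \<alpha>) / lam) *\<^sub>R w)"
    unfolding C_def by (metis coercive_inv_right[OF A])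
  then have "S = (N * (lam + \<alpha>)) *\<^sub>R w"
    using lam by (simp add: matrix_vector_mult_scaleR Aw)
  then show ?thesis
    by (simp add: S_def y_def N_def \<alpha>_def power2_norm_eq_inner)
qed

text \<open>A squared column norm is either 0 or \<theta>/n - \<lambda> for an eigenvalue \<theta>
  of the self-adjoint scatter operator \<open>T\<close>.\<close>

lemma finite_minimiser_column_norms:
  fixes x :: "nat \<Rightarrow> real^'d"
  assumes "0 < lam" "1 \<le> n"
  shows "finite {(norm (column j W))\<^sup>2 | (W :: real^'k^'d). global_min (loss_sep n x b lam) W}"
proof -
  define T where "T v = (\<Sum>i = 1..n. ((x i - b) \<bullet> v) *\<^sub>R (x i - b))" for v
  have "T u \<bullet> v = u \<bullet> T v" for u v
    unfolding T_def inner_sum_left inner_sum_right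
    by (simp add: inner_commute mult.commute)
  then have "finite {\<theta>. \<exists>v. v \<noteq> 0 \<and> T v = \<theta> *\<^sub>R v}"
    by (rule finite_eigenvalues_self_adjoint)
  moreover have "(norm (column j W))\<^sup>2 \<in>
      insert 0 ((\<lambda>\<theta>. \<theta> / real n - lam) ` {\<theta>. \<exists>v. v \<noteq> 0 \<and> T v = \<theta> *\<^sub>R v})"
    if "global_min (loss_sep n x b lam) W" for W :: "real^'k^'d"
  proof (cases "column j W = 0")
    case False
    then have "T (column j W) = (real n * (lam + (norm (column j W))\<^sup>2)) *\<^sub>R column j W"
      unfolding T_def using assms that by (intro minimiser_column_eigenvector)
    then show ?thesis
      using False assms(2)
      by (intro insertI2 image_eqI[of _ _ "real n * (lam + (norm (column j W))\<^sup>2)"]) auto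
  qed auto
  then have "{(norm (column j W))\<^sup>2 | (W :: real^'k^'d). global_min (loss_sep n x b lam) W} \<subseteq>
      insert 0 ((\<lambda>\<theta>. \<theta> / real n - lam) ` {\<theta>. \<exists>v. v \<noteq> 0 \<and> T v = \<theta> *\<^sub>R v})"
    by blast
  ultimately show ?thesis
    by (meson finite_imageI finite_insert finite_subset)
qed

lemma disconnected_minima:
  fixes X Y :: "real^'k^'d"
  assumes "0 < lam" "1 \<le> n" "global_min (loss_sep n x b lam) X"
    and "norm (column j X) \<noteq> norm (column j Y)"
  shows "disconnected (loss_sep n x b lam) X Y"
  unfolding disconnected_def
proof (intro allI impI)
  let ?f = "loss_sep n x b lam"
  fix g assume g: "path g \<and> pathstart g = X \<and> pathfinish g = Y"
  show "\<exists>s t. 0 \<le> s \<and> s < t \<and> t \<le> 1 \<and> ?f (g s) < ?f (g t)"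
  proof (rule ccontr)
    assume "\<not> ?thesis"
    then have "?f (g t) \<le> ?f (g s)" if "0 \<le> s" "s < t" "t \<le> 1" for s t
      using that by (meson not_less)
    from this[of 0] have "?f (g t) \<le> ?f (g 0)" if "0 \<le> t" "t \<le> 1" for t
      using that by (cases "t = 0") auto
    \<comment> \<open>A path that never ascends from a minimum stays among the minima.\<close>
    then have min: "global_min ?f (g t)" if "t \<in> {0..1}" for t
      using that assms(3) g unfolding global_min_iff pathstart_def
      by (metis atLeastAtMost_iff order_trans)
    define N where "N t = (norm (column j (g t)))\<^sup>2" for t
    have "continuous_on {0..1} N"
      using g unfolding N_def column_def path_def by (auto intro!: continuous_intros)
    then have "connected (N ` {0..1})"
      by (intro connected_continuous_image) auto
    moreover have "finite (N ` {0..1})"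
      by (rule finite_subset[OF _ finite_minimiser_column_norms[OF assms(1,2), where j = j and x = x and b = b]])
        (use min in \<open>auto simp: N_def\<close>)
    \<comment> \<open>A nonempty connected finite set of reals is a single point.\<close>
    ultimately obtain a where "N ` {0..1} = {a}"
      using connected_finite_iff_sing[of "N ` {0..1}"] by auto
    moreover have "N 0 \<in> N ` {0..1}" "N 1 \<in> N ` {0..1}"
      by auto
    ultimately have "N 0 = N 1"
      by simp
    then show False
      using assms(4) g by (simp add: N_def pathstart_def pathfinish_def)
  qed
qed

subsection \<open>Singular value decompositions\<close>

text \<open>The number of predecessors is the position of an index, counted from 0. Positions make
  row and column indices comparable although their types differ.\<close>

lemma bij_betw_card_lessThan:
  "bij_betw (\<lambda>i :: 'a::{finite,linorder}. card {..<i}) UNIV {..<CARD('a)}"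
proof -
  have "card {..<i} < card {..<j}" if "i < j" for i j :: 'a
    using that by (intro psubset_card_mono) auto
  then have "strict_mono (\<lambda>i :: 'a. card {..<i})"
    by (rule strict_monoI)
  then have inj: "inj (\<lambda>i :: 'a. card {..<i})"
    by (rule strict_mono_imp_inj_on)
  have "card {..<i} < CARD('a)" for i :: 'a
    by (intro psubset_card_mono) auto
  then have "range (\<lambda>i :: 'a. card {..<i}) = {..<CARD('a)}"
    using card_image[OF inj] by (intro card_subset_eq) auto
  then show ?thesis
    using inj by (simp add: bij_betw_def)
qed

lemma card_lessThan_eq_iff [simp]:
  "card {..<i} = card {..<j} \<longleftrightarrow> i = (j :: 'a::{finite,linorder})"
  using bij_betw_card_lessThan[where 'a = 'a] by (auto simp: bij_betw_def inj_on_def)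

lemma bij_betw_card_lessThan_below:
  assumes "r \<le> CARD('a)"
  shows "bij_betw (\<lambda>i :: 'a::{finite,linorder}. card {..<i}) {i. card {..<i} < r} {..<r}"
proof (rule bij_betw_subset[OF bij_betw_card_lessThan])
  have "\<exists>i :: 'a. card {..<i} = q" if "q < r" for q
    using that assms bij_betw_card_lessThan[where 'a = 'a] unfolding bij_betw_def
    by (metis (mono_tags, lifting) imageE lessThan_iff order_less_le_trans)
  then show "(\<lambda>i :: 'a. card {..<i}) ` {i. card {..<i} < r} = {..<r}"
    by force
qed simp

text \<open>The complements of \<open>A\<close> and \<open>B\<close> have the same size. This
  completes an enumeration of the nonzero columns to a permutation and to a basis.\<close>

lemma bij_betw_extend:
  assumes f: "bij_betw f A B" and "A \<subseteq> X" "B \<subseteq> Y" "finite X" "finite Y" "card X = card Y"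
  obtains g where "bij_betw g X Y" "\<And>a. a \<in> A \<Longrightarrow> g a = f a"
proof -
  have "finite A" "finite B"
    using assms finite_subset by blast+
  then have "card (X - A) = card (Y - B)"
    using assms bij_betw_same_card[OF f] by (simp add: card_Diff_subset)
  then obtain h where h: "bij_betw h (X - A) (Y - B)"
    using finite_same_card_bij[of "X - A" "Y - B"] \<open>finite X\<close> \<open>finite Y\<close> by auto
  let ?g = "\<lambda>a. if a \<in> A then f a else h a"
  have "bij_betw ?g A B"
    using f by (subst bij_betw_cong[of A ?g f]) auto
  moreover have "bij_betw ?g (X - A) (Y - B)"
    using h by (subst bij_betw_cong[of "X - A" ?g h]) auto
  ultimately have "bij_betw ?g (A \<union> (X - A)) (B \<union> (Y - B))"
    by (rule bij_betw_combine) auto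
  moreover have "A \<union> (X - A) = X" "B \<union> (Y - B) = Y"
    using assms by auto
  ultimately show ?thesis
    using that[of ?g] by simp
qed

section \<open>Permutation matrices and rank for orthogonal columns\<close>

abbreviation perm_mat :: "('n \<Rightarrow> 'n) \<Rightarrow> real^'n^'n" where
  "perm_mat p \<equiv> (\<chi> i j. if i = p j then 1 else 0)"

lemma column_mult_perm_mat: "column j (W ** perm_mat p) = column (p j) W"
  by (simp add: column_def matrix_matrix_mult_def vec_eq_iff if_distrib[of "\<lambda>a. _ * a"] cong: if_cong)

lemma orthogonal_perm_mat:
  assumes "inj p"
  shows "orthogonal_matrix (perm_mat p)"
proof -
  have "(\<Sum>k\<in>UNIV. (if k = p i then 1 else 0) * (if k = p j then 1 else 0)) =
      (if i = j then 1 else 0 :: real)" for i j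
    using assms by (auto simp: if_distrib[of "\<lambda>a. a * _"] inj_eq cong: if_cong)
  then show ?thesis
    by (simp add: orthogonal_matrix matrix_matrix_mult_def vec_eq_iff transpose_def mat_def)
qed

lemma gram_mult_orthogonal:
  assumes "orthogonal_matrix R"
  shows "(W ** R) ** transpose (W ** R) = W ** transpose (W :: real^'k^'d)"
proof -
  have "(W ** R) ** transpose (W ** R) = W ** (R ** transpose R) ** transpose W"
    by (simp add: matrix_transpose_mul matrix_mul_assoc)
  then show ?thesis
    using assms by (simp add: orthogonal_matrix_def)
qed

lemma orthogonal_columns_inj:
  assumes "orthogonal_columns W"
  shows "inj_on (\<lambda>j. column j W) {j. column j W \<noteq> 0}"
proof (rule inj_onI, rule ccontr)
  fix i j assume *: "i \<in> {j. column j W \<noteq> 0}" "column i W = column j W" "i \<noteq> j"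
  then have "column i W \<bullet> column i W = 0"
    using assms by (metis orthogonal_columns_def)
  then show False
    using * by simp
qed

lemma orthogonal_columns_pairwise:
  assumes "orthogonal_columns W"
  shows "pairwise orthogonal ((\<lambda>j. column j W) ` {j. column j W \<noteq> 0})"
proof (rule pairwiseI)
  fix u v assume "u \<in> (\<lambda>j. column j W) ` {j. column j W \<noteq> 0}"
    "v \<in> (\<lambda>j. column j W) ` {j. column j W \<noteq> 0}" "u \<noteq> v"
  then obtain i j where "u = column i W" "v = column j W" "i \<noteq> j"
    by blast
  then show "orthogonal u v"
    using assms by (simp add: orthogonal_columns_def orthogonal_def)
qed

text \<open>The nonzero columns are pairwise distinct and independent, and the zero vector does not
  affect the span.\<close>

lemma rank_orthogonal_columns:
  fixes W :: "real^'k^'d"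
  assumes "orthogonal_columns W"
  shows "rank W = nonzero_columns W"
proof -
  let ?B = "(\<lambda>j. column j W) ` {j. column j W \<noteq> 0}"
  have "independent ?B"
    by (rule pairwise_orthogonal_independent[OF orthogonal_columns_pairwise[OF assms]]) auto
  moreover have "?B = columns W - {0}"
    by (auto simp: columns_def)
  ultimately have "dim (columns W) = card ?B"
    by (metis dim_eq_card span_delete_0)
  then show ?thesis
    using card_image[OF orthogonal_columns_inj[OF assms]]
    by (simp add: column_rank_def nonzero_columns_def)
qed

lemma orthogonal_columns_mult_perm_mat:
  "orthogonal_columns W \<Longrightarrow> inj p \<Longrightarrow> orthogonal_columns (W ** perm_mat p)"
  by (simp add: orthogonal_columns_def column_mult_perm_mat inj_eq)

text \<open>The normalised nonzero columns, completed to an orthonormal basis, form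
  \<open>U\<close>; the column norms are the singular values; the right factor is a permutation that
  brings the nonzero columns to the first \<open>r\<close> positions.\<close>

lemma ex_svd_orthogonal_columns:
  fixes W :: "real^'k::{finite,linorder}^'d::{finite,linorder}"
  assumes W: "orthogonal_columns W"
  shows "\<exists>U S V. is_svd W U S V"
proof -
  define J where "J = {j. column j W \<noteq> 0}"
  define r where "r = card J"
  define N where "N = (\<lambda>j. column j W) ` J"
  note pw = orthogonal_columns_pairwise[OF W, folded J_def, folded N_def]
  have cN: "bij_betw (\<lambda>j. column j W) J N"
    using orthogonal_columns_inj[OF W] by (simp add: bij_betw_def N_def J_def)
  obtain B0 where B0: "B0 \<inter> insert 0 N = {}" "pairwise orthogonal (N \<union> B0)"
    "span (N \<union> B0) = span (N \<union> UNIV)"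
    using orthogonal_extension_strong[OF pw] by blast
  define B where "B = N \<union> B0"
  have B_nz: "0 \<notin> B"
    using B0(1) by (auto simp: B_def N_def J_def)
  have indep: "independent B"
    using B0(2) B_nz unfolding B_def by (intro pairwise_orthogonal_independent)
  have "span B = UNIV"
    using B0(3) by (simp add: B_def)
  then have card_B: "card B = CARD('d)"
    using indep dim_eq_card[of B UNIV] by simp
  have fin_B: "finite B"
    using indep by (rule finiteI_independent)
  have "r = card N"
    using cN by (simp add: r_def bij_betw_same_card)
  then have r_d: "r \<le> CARD('d)"
    using card_mono[OF fin_B, of N] by (simp add: B_def card_B[unfolded B_def])
  have r_k: "r \<le> CARD('k)"
    unfolding r_def by (intro card_mono) auto
  \<comment> \<open>One enumeration of the nonzero columns governs both the order of the columns of
    \<open>W\<close> and the order of the basis, so that the two match along the diagonal.\<close>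
  obtain \<sigma> where \<sigma>: "bij_betw \<sigma> {..<r} J"
    using ex_bij_betw_nat_finite[of J] by (auto simp: r_def atLeast0LessThan)
  let ?pk = "\<lambda>j :: 'k. card {..<j}" and ?pd = "\<lambda>a :: 'd. card {..<a}"
  have \<sigma>k: "bij_betw (\<sigma> \<circ> ?pk) {j. ?pk j < r} J"
    using bij_betw_trans[OF bij_betw_card_lessThan_below[OF r_k] \<sigma>] .
  obtain p where p: "bij_betw p UNIV UNIV" "\<And>j. ?pk j < r \<Longrightarrow> p j = \<sigma> (?pk j)"
    using bij_betw_extend[OF \<sigma>k, of UNIV UNIV] by auto
  have \<sigma>d: "bij_betw ((\<lambda>j. column j W) \<circ> (\<sigma> \<circ> ?pd)) {a. ?pd a < r} N"
    using bij_betw_trans[OF bij_betw_trans[OF bij_betw_card_lessThan_below[OF r_d] \<sigma>] cN] .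
  obtain e where e: "bij_betw e UNIV B" "\<And>a. ?pd a < r \<Longrightarrow> e a = column (\<sigma> (?pd a)) W"
    using bij_betw_extend[OF \<sigma>d, of UNIV B] fin_B card_B by (auto simp: B_def)
  have inj_p: "inj p"
    using p(1) by (simp add: bij_betw_def)
  define U :: "real^'d::{finite,linorder}^'d::{finite,linorder}" where "U = (\<chi> q a. ((1 / norm (e a)) *\<^sub>R e a) $ q)"
  define S :: "real^'k::{finite,linorder}^'d::{finite,linorder}" where "S = (\<chi> a j. if ?pd a = ?pk j then norm (column (p j) W) else 0)"
  have colU: "column a U = (1 / norm (e a)) *\<^sub>R e a" for a
    by (simp add: U_def column_def vec_eq_iff)
  have e_nz: "e a \<noteq> 0" for a
    using e(1) B_nz by (metis UNIV_I bij_betw_apply)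
  have "e a \<bullet> e a' = 0" if "a \<noteq> a'" for a a'
    using B0(2) e(1) that unfolding B_def[symmetric] pairwise_def orthogonal_def bij_betw_def
    by (metis injD rangeI)
  then have "orthogonal_matrix U"
    using e_nz by (simp add: orthogonal_matrix_orthonormal_columns colU orthogonal_def)
  moreover have "rectangular_diagonal S" "\<forall>a j. 0 \<le> S $ a $ j"
    by (simp_all add: S_def rectangular_diagonal_def)
  moreover have "U ** S = W ** perm_mat p"
  proof -
    have "(U ** S) $ q $ j = W $ q $ p j" for q j
    proof (cases "?pk j < r")
      case True
      then have "?pk j \<in> ?pd ` UNIV"
        using bij_betw_card_lessThan[where 'a = 'd] r_d by (simp add: bij_betw_def)
      then obtain a where a: "?pd a = ?pk j"
        by auto
      then have ea: "e a = column (p j) W"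
        using True e(2)[of a] p(2)[of j] by simp
      have "S $ a' $ j = (if a' = a then norm (column (p j) W) else 0)" for a'
        by (simp add: S_def a[symmetric])
      then have "(U ** S) $ q $ j = U $ q $ a * norm (column (p j) W)"
        by (simp add: matrix_matrix_mult_def if_distrib[of "\<lambda>z. _ * z"] cong: if_cong)
      also have "\<dots> = column (p j) W $ q"
        using e_nz[of a] by (simp add: U_def ea)
      finally show ?thesis
        by (simp add: column_def)
    next
      case False
      \<comment> \<open>The first \<open>r\<close> positions already exhaust \<open>J\<close>, and
        \<open>p\<close> is injective.\<close>
      have "p j \<notin> J"
      proof
        assume "p j \<in> J"
        then obtain j' where "?pk j' < r" "p j = \<sigma> (?pk j')"
          using \<sigma>k unfolding bij_betw_def by auto
        then have "p j = p j'"
          using p(2) by simp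
        then show False
          using False inj_p \<open>?pk j' < r\<close> by (simp add: inj_eq)
      qed
      then have zero: "column (p j) W = 0"
        by (simp add: J_def)
      then have "S $ a $ j = 0" for a
        by (simp add: S_def)
      then have "(U ** S) $ q $ j = 0"
        by (simp add: matrix_matrix_mult_def)
      then show ?thesis
        using zero by (simp add: column_def vec_eq_iff)
    qed
    then show ?thesis
      by (simp add: vec_eq_iff matrix_matrix_mult_def if_distrib[of "\<lambda>a. _ * a"] cong: if_cong)
  qed
  then have "U ** S ** transpose (perm_mat p) = W ** (perm_mat p ** transpose (perm_mat p))"
    by (simp add: matrix_mul_assoc)
  then have "W = U ** S ** transpose (perm_mat p)"
    using orthogonal_perm_mat[OF inj_p] by (simp add: orthogonal_matrix_def)
  ultimately have "is_svd W U S (perm_mat p)"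
    using orthogonal_perm_mat[OF inj_p] by (simp add: is_svd_def)
  then show ?thesis
    by blast
qed

section \<open>Characteristic polynomials and repeated eigenvalues\<close>

lemma poly_det: "poly (det M) x = det (\<chi> i j. poly (M $ i $ j) x)"
  for M :: "real poly^'n^'n"
  by (simp add: det_def poly_sum poly_prod)

lemma poly_charpoly: "poly (charpoly A) x = det (mat x - A)"
proof -
  have "(\<chi> i j. poly ((mat [:0, 1:] - (\<chi> i j. [:A $ i $ j:])) $ i $ j) x) = mat x - A"
    by (simp add: vec_eq_iff mat_def)
  then show ?thesis
    unfolding charpoly_def poly_det by (rule arg_cong)
qed

lemma matrix_diff_distrib:
  fixes A :: "real^'n^'m"
  shows "A ** (B - C) = A ** B - A ** C" "(B' - C') ** A = B' ** A - C' ** A"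
  by (simp_all add: matrix_matrix_mult_def vec_eq_iff left_diff_distrib right_diff_distrib sum_subtractf)

text \<open>Real polynomials are determined by their values, and at each point \<open>mat x\<close>
  commutes with \<open>U\<close>, so the orthogonal factors drop out of the determinant.\<close>

lemma charpoly_diagonalised:
  fixes U D :: "real^'n^'n"
  assumes U: "orthogonal_matrix U" and D: "\<And>i j. i \<noteq> j \<Longrightarrow> D $ i $ j = 0"
  shows "charpoly (U ** D ** transpose U) = (\<Prod>i\<in>UNIV. [:- (D $ i $ i), 1:])"
proof -
  have "poly (charpoly (U ** D ** transpose U)) x = poly (\<Prod>i\<in>UNIV. [:- (D $ i $ i), 1:]) x" for x
  proof -
    have UU: "U ** transpose U = mat 1"
      using U by (simp add: orthogonal_matrix_def)
    have "U ** mat x = mat x ** U"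
      by (simp add: matrix_matrix_mult_def mat_def vec_eq_iff if_distrib[of "\<lambda>a. _ * a"]
          if_distrib[of "\<lambda>a. a * _"] mult.commute cong: if_cong)
    then have "U ** mat x ** transpose U = mat x"
      by (metis UU matrix_mul_assoc matrix_mul_rid)
    then have "mat x - U ** D ** transpose U = U ** (mat x - D) ** transpose U"
      by (simp add: matrix_diff_distrib)
    moreover have "det U * det (transpose U) = 1"
      by (metis UU det_mul det_I)
    ultimately have "det (mat x - U ** D ** transpose U) = det (mat x - D)"
      by (simp add: det_mul mult.commute mult.left_commute)
    also have "\<dots> = (\<Prod>i\<in>UNIV. x - D $ i $ i)"
      by (subst det_diagonal) (auto simp: mat_def D)
    finally show ?thesis
      by (simp add: poly_charpoly poly_prod)
  qed
  then show ?thesis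
    by (simp add: poly_eq_poly_eq_iff[symmetric] fun_eq_iff)
qed

lemma order_prod_linear_ge_2:
  fixes f :: "'n::finite \<Rightarrow> real"
  assumes "i \<noteq> j" "f i = \<mu>" "f j = \<mu>"
  shows "2 \<le> order \<mu> (\<Prod>i\<in>UNIV. [:- f i, 1:])"
proof -
  let ?p = "\<Prod>i\<in>UNIV. [:- f i, 1:]"
  have "?p = [:- f i, 1:] * (\<Prod>i\<in>UNIV - {i}. [:- f i, 1:])"
    by (rule prod.remove) auto
  also have "(\<Prod>i\<in>UNIV - {i}. [:- f i, 1:]) =
      [:- f j, 1:] * (\<Prod>i\<in>UNIV - {i} - {j}. [:- f i, 1:])"
    using assms(1) by (intro prod.remove) auto
  finally have "?p = [:- f i, 1:] * [:- f j, 1:] * (\<Prod>i\<in>UNIV - {i} - {j}. [:- f i, 1:])"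
    by (simp only: mult.assoc)
  then have "[:- \<mu>, 1:] ^ 2 dvd ?p"
    unfolding assms(2,3) power2_eq_square by (metis dvd_triv_left)
  moreover have "?p \<noteq> 0"
    by simp
  ultimately show ?thesis
    by (simp add: order_divides)
qed

section \<open>Columns of the product of the left singular vectors and the singular values\<close>

context
  fixes W :: "real^'k::{finite,linorder}^'d::{finite,linorder}" and U S V
  assumes svd: "is_svd W U S V"
begin

lemma svd_mult_eq: "U ** S = W ** V"
proof -
  have "W ** V = U ** S ** (transpose V ** V)"
    using svd by (simp add: is_svd_def matrix_mul_assoc)
  then show ?thesis
    using svd by (simp add: is_svd_def orthogonal_matrix_def)
qed

lemma svd_gram: "(U ** S) ** transpose (U ** S) = W ** transpose W"
  unfolding svd_mult_eq using svd by (intro gram_mult_orthogonal) (simp add: is_svd_def)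

lemma svd_entry_unique:
  "S $ a $ j \<noteq> 0 \<Longrightarrow> S $ a' $ j' \<noteq> 0 \<Longrightarrow> a = a' \<longleftrightarrow> j = j'"
  using svd unfolding is_svd_def rectangular_diagonal_def by (metis card_lessThan_eq_iff)

lemma svd_inner_columns: "column i (U ** S) \<bullet> column j (U ** S) = (\<Sum>a\<in>UNIV. S $ a $ i * S $ a $ j)"
proof -
  have "transpose (U ** S) ** (U ** S) = transpose S ** (transpose U ** U) ** S"
    by (simp add: matrix_transpose_mul matrix_mul_assoc)
  also have "\<dots> = transpose S ** S"
    using svd by (simp add: is_svd_def orthogonal_matrix_def)
  finally have "(transpose (U ** S) ** (U ** S)) $ i $ j = (transpose S ** S) $ i $ j"
    by simp
  then show ?thesis
    by (simp add: matrix_mult_transpose_dot_column) (simp add: column_def inner_vec_def)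
qed

lemma svd_orthogonal_columns: "orthogonal_columns (U ** S)"
  unfolding orthogonal_columns_def svd_inner_columns
  by (intro allI impI sum.neutral ballI) (metis mult_eq_0_iff svd_entry_unique)

text \<open>Column \<open>j\<close> of \<open>S\<close> has a single nonzero entry, which is also
  alone in its row. Both sums therefore reduce to its square.\<close>

lemma svd_column_eigenvalue:
  assumes "column j (U ** S) \<noteq> 0"
  obtains a where "S $ a $ j \<noteq> 0" "(norm (column j (U ** S)))\<^sup>2 = (S ** transpose S) $ a $ a"
proof -
  have "(\<Sum>a\<in>UNIV. S $ a $ j * S $ a $ j) \<noteq> 0"
    using assms svd_inner_columns[of j j] by (metis inner_eq_zero_iff)
  then have "\<not> (\<forall>a. S $ a $ j = 0)"
    by (rule contrapos_nn) simp
  then obtain a where a: "S $ a $ j \<noteq> 0"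
    by blast
  have "(norm (column j (U ** S)))\<^sup>2 = (\<Sum>a'\<in>UNIV. S $ a' $ j * S $ a' $ j)"
    by (simp add: power2_norm_eq_inner svd_inner_columns)
  also have "\<dots> = (\<Sum>a'\<in>{a}. S $ a' $ j * S $ a' $ j)"
    using svd_entry_unique[OF a] by (intro sum.mono_neutral_right) auto
  also have "\<dots> = (\<Sum>j'\<in>{j}. S $ a $ j' * S $ a $ j')"
    by simp
  also have "\<dots> = (\<Sum>j'\<in>UNIV. S $ a $ j' * S $ a $ j')"
    using svd_entry_unique[OF a] by (intro sum.mono_neutral_left) auto
  finally show ?thesis
    using that[OF a] by (simp add: mult_transpose_nth)
qed

text \<open>Two nonzero columns of equal norm would give two equal diagonal entries of
  \<open>S ** transpose S\<close>, hence a nonzero root of the characteristic polynomial of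
  multiplicity at least 2.\<close>

lemma svd_distinct_column_norms:
  assumes "distinct_nonzero_eigenvalues (W ** transpose W)"
    and "column i (U ** S) \<noteq> 0" "norm (column i (U ** S)) = norm (column j (U ** S))"
  shows "i = j"
proof (rule ccontr)
  assume "i \<noteq> j"
  define \<mu> where "\<mu> = (norm (column i (U ** S)))\<^sup>2"
  have \<mu>: "\<mu> \<noteq> 0"
    using assms(2) by (simp add: \<mu>_def)
  obtain a where a: "S $ a $ i \<noteq> 0" "\<mu> = (S ** transpose S) $ a $ a"
    using svd_column_eigenvalue[OF assms(2)] unfolding \<mu>_def by blast
  have "column j (U ** S) \<noteq> 0"
    using assms(2,3) by (metis norm_eq_zero)
  then obtain a' where a': "S $ a' $ j \<noteq> 0" "\<mu> = (S ** transpose S) $ a' $ a'"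
    using svd_column_eigenvalue unfolding \<mu>_def assms(3) by blast
  have "a \<noteq> a'"
    using svd_entry_unique[OF a(1) a'(1)] \<open>i \<noteq> j\<close> by simp
  have diag: "(S ** transpose S) $ c $ c' = 0" if "c \<noteq> c'" for c c'
    unfolding mult_transpose_nth using that svd_entry_unique[of c _ c']
    by (intro sum.neutral ballI) (metis mult_eq_0_iff)
  have "W ** transpose W = U ** (S ** transpose S) ** transpose U"
    unfolding svd_gram[symmetric] by (simp add: matrix_transpose_mul matrix_mul_assoc)
  then have "charpoly (W ** transpose W) = (\<Prod>c\<in>UNIV. [:- ((S ** transpose S) $ c $ c), 1:])"
    using charpoly_diagonalised[of U "S ** transpose S"] svd diag by (simp add: is_svd_def)
  then have "2 \<le> order \<mu> (charpoly (W ** transpose W))"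
    using order_prod_linear_ge_2[OF \<open>a \<noteq> a'\<close>, of "\<lambda>c. (S ** transpose S) $ c $ c" \<mu>] a a' by simp
  then show False
    using assms(1) \<mu> unfolding distinct_nonzero_eigenvalues_def by force
qed

end

subsection \<open>Permuting and spreading columns\<close>

text \<open>Permutations with the same result differ only by a permutation of the zero columns,
  which bounds each fibre by (\<kappa> - r)! with r the number of nonzero columns. The product form
  avoids division of natural numbers.\<close>

lemma card_column_permutations:
  fixes T :: "real^'k^'d"
  assumes inj: "inj_on (\<lambda>j. column j T) {j. column j T \<noteq> 0}"
  shows "fact CARD('k) \<le> card ((\<lambda>p. T ** perm_mat p) ` {p. p permutes UNIV}) *
    fact (CARD('k) - nonzero_columns T)"
proof -
  let ?Pi = "{p :: 'k \<Rightarrow> 'k. p permutes UNIV}"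
  let ?f = "\<lambda>p. T ** perm_mat p"
  define Z where "Z = {l. column l T = 0}"
  have fin: "finite ?Pi"
    by (simp add: finite_permutations)
  have "Z = UNIV - {l. column l T \<noteq> 0}"
    by (auto simp: Z_def)
  then have card_Z: "card Z = CARD('k) - nonzero_columns T"
    by (simp add: card_Diff_subset nonzero_columns_def)
  have fibre: "card {p \<in> ?Pi. ?f p = y} \<le> fact (CARD('k) - nonzero_columns T)" if y: "y \<in> ?f ` ?Pi" for y
  proof -
    obtain p0 where p0: "p0 permutes UNIV" "y = ?f p0"
      using y by blast
    have "p \<circ> inv p0 permutes Z" if p: "p permutes UNIV" "?f p = y" for p
    proof (rule permutes_superset)
      show "p \<circ> inv p0 permutes UNIV"
        using p(1) p0(1) by (simp add: permutes_compose permutes_inv)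
      fix l assume l: "l \<in> UNIV - Z"
      have "column ((p \<circ> inv p0) l) T = column (p0 (inv p0 l)) T"
        using p(2) p0(2) by (metis column_mult_perm_mat comp_apply)
      then have "column ((p \<circ> inv p0) l) T = column l T"
        using permutes_inverses(1)[OF p0(1)] by simp
      then show "(p \<circ> inv p0) l = l"
        using inj_onD[OF inj, of "(p \<circ> inv p0) l" l] l by (simp add: Z_def)
    qed
    then have "(\<lambda>p. p \<circ> inv p0) ` {p \<in> ?Pi. ?f p = y} \<subseteq> {q. q permutes Z}"
      by auto
    moreover have "inj_on (\<lambda>p. p \<circ> inv p0) {p \<in> ?Pi. ?f p = y}"
      using permutes_inverses[OF p0(1)] by (intro inj_onI) (metis (no_types, lifting) comp_assoc comp_id permutes_inv_o(2)[OF p0(1)])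
    ultimately have "card {p \<in> ?Pi. ?f p = y} \<le> card {q. q permutes Z}"
      by (meson card_inj_on_le finite_permutations finite)
    then show ?thesis
      by (simp add: card_permutations[OF card_Z])
  qed
  have "card ?Pi = (\<Sum>y\<in>?f ` ?Pi. card {p \<in> ?Pi. ?f p = y})"
    using sum.image_gen[OF fin, of "\<lambda>_. 1 :: nat" ?f] by simp
  also have "\<dots> \<le> (\<Sum>y\<in>?f ` ?Pi. fact (CARD('k) - nonzero_columns T))"
    using fibre by (intro sum_mono) auto
  finally show ?thesis
    by (simp add: card_permutations)
qed

text \<open>A nonzero column may be replaced by t copies scaled by 1/sqrt(t), the extra copies
  filling zero columns: the sum of the outer products is unchanged.\<close>

lemma ex_spread_columns:
  fixes W :: "real^'k^'d"
  assumes "0 < nonzero_columns W" "nonzero_columns W \<le> m" "m \<le> CARD('k)"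
  obtains X :: "real^'k^'d" where "X ** transpose X = W ** transpose W" "nonzero_columns X = m"
proof -
  define J where "J = {j. column j W \<noteq> 0}"
  have cJ: "card J = nonzero_columns W"
    by (simp add: J_def nonzero_columns_def)
  then obtain j0 where j0: "j0 \<in> J"
    using assms(1) by (metis card.empty equals0I less_irrefl)
  have "m - card J \<le> card (UNIV - J)"
    using assms(3) by (simp add: card_Diff_subset)
  then obtain Z where Z: "Z \<subseteq> UNIV - J" "card Z = m - card J"
    by (meson obtain_subset_with_card_n)
  define T where "T = insert j0 Z"
  define c where "c = 1 / sqrt (card T)"
  define X :: "real^'k^'d" where "X = (\<chi> q l. if l \<in> T then c * W $ q $ j0 else W $ q $ l)"
  have T: "card T > 0"
    by (simp add: T_def card_gt_0_iff)
  have "1 / sqrt t \<noteq> 0 \<and> t * (1 / sqrt t * (1 / sqrt t)) = 1" if "t > 0" for t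
    using that by simp
  then have c: "c \<noteq> 0" "real (card T) * (c * c) = 1"
    using T unfolding c_def by (metis of_nat_0_less_iff)+
  have zero: "W $ q $ l = 0" if "l \<in> Z" for q l
    using that Z(1) by (auto simp: J_def column_def vec_eq_iff)
  have "(\<Sum>l\<in>UNIV. X $ q $ l * X $ q' $ l) = (\<Sum>l\<in>UNIV. W $ q $ l * W $ q' $ l)" for q q'
  proof -
    have split: "(\<Sum>l\<in>UNIV. f l) = (\<Sum>l\<in>T. f l) + (\<Sum>l\<in>UNIV - T. f l)" for f :: "'k \<Rightarrow> real"
      by (metis add.commute finite subset_UNIV sum.subset_diff)
    have "(\<Sum>l\<in>T. X $ q $ l * X $ q' $ l) = (real (card T) * (c * c)) * (W $ q $ j0 * W $ q' $ j0)"
      by (simp add: X_def)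
    also have "\<dots> = W $ q $ j0 * W $ q' $ j0"
      using c by simp
    also have "\<dots> = (\<Sum>l\<in>T. W $ q $ l * W $ q' $ l)"
    proof -
      have "j0 \<notin> Z"
        using j0 Z(1) by auto
      then show ?thesis
        by (simp add: T_def zero)
    qed
    finally show ?thesis
      unfolding split by (simp add: X_def)
  qed
  then have "X ** transpose X = W ** transpose W"
    by (simp add: vec_eq_iff mult_transpose_nth)
  moreover have "nonzero_columns X = m"
  proof -
    have "column l X = (if l \<in> T then c *\<^sub>R column j0 W else column l W)" for l
      by (simp add: X_def column_def vec_eq_iff)
    then have "{l. column l X \<noteq> 0} = J \<union> Z"
      using j0 c(1) by (auto simp: J_def T_def)
    moreover have "card (J \<union> Z) = card J + card Z"
      using Z(1) by (intro card_Un_disjoint) auto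
    ultimately show ?thesis
      using Z(2) cJ assms(2) by (simp add: nonzero_columns_def)
  qed
  ultimately show ?thesis
    using that by blast
qed

text \<open>For \<open>n = 0\<close> both losses vanish identically and every matrix is a minimum,
  which \<open>1 \<le> n\<close> excludes. Existence of an SVD accompanies the claim about all SVDs,
  so that the latter is not vacuous. If the rank of \<open>W2\<close> is 0, its Gram matrix vanishes
  and there is no column to spread; hence the proviso on \<open>m\<close>.\<close>

theorem theorem2:
  fixes n :: nat
    and x :: "nat \<Rightarrow> real^'d::{finite,linorder}"
    and b :: "real^'d::{finite,linorder}"
    and lam :: real
    and W1 W2 :: "real^'k::{finite,linorder}^'d::{finite,linorder}"
  assumes "1 \<le> n"
    and "0 < lam"
    and "global_min (loss n x b lam) W1"
    and "global_min (loss_sep n x b lam) W2"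
  shows
    "(\<forall>R P. rotation_matrix R \<and> permutation_matrix P \<longrightarrow>
        loss n x b lam W1 = loss n x b lam (W1 ** R) \<and>
        loss n x b lam (W1 ** R) = loss_sep n x b lam W2 \<and>
        loss_sep n x b lam W2 = loss n x b lam (W2 ** P) \<and>
        loss n x b lam (W2 ** P) = loss_sep n x b lam (W2 ** P))
     \<and>
     (distinct_nonzero_eigenvalues (W2 ** transpose W2) \<longrightarrow>
        (\<exists>U S V. is_svd W2 U S V) \<and>
        (\<forall>U S V. is_svd W2 U S V \<longrightarrow>
          (\<exists>M \<subseteq> {U ** S ** P | P. permutation_matrix P}.
             finite M \<and>
             real (card M) \<ge> fact CARD('k) / fact (CARD('k) - rank W2) \<and>
             (\<forall>A\<in>M. global_min (loss_sep n x b lam) A) \<and>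
             (\<forall>A\<in>M. \<forall>B\<in>M. A \<noteq> B \<longrightarrow> disconnected (loss_sep n x b lam) A B))))
     \<and>
     (nonzero_columns W2 \<le> rank W2 \<and>
      (\<forall>m\<in>{rank W2..CARD('k)}. 0 < rank W2 \<or> m = rank W2 \<longrightarrow>
         (\<exists>W::real^'k::{finite,linorder}^'d::{finite,linorder}. global_min (loss n x b lam) W \<and> nonzero_columns W = m)))"
proof -
  note n = assms(1) and lam = assms(2) and min1 = assms(3) and min2 = assms(4)
  note W2 = global_min_loss_sepD[OF lam n min2]
  have rank: "rank W2 = nonzero_columns W2"
    by (rule rank_orthogonal_columns[OF W2(2)])
  have "loss n x b lam W1 = loss n x b lam W2"
    using min1 W2(1) unfolding global_min_iff by (intro antisym) auto
  then have eq: "loss n x b lam W1 = loss_sep n x b lam W2"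
    using W2(3) by simp
  have 1: "loss n x b lam W1 = loss n x b lam (W1 ** R) \<and>
        loss n x b lam (W1 ** R) = loss_sep n x b lam W2 \<and>
        loss_sep n x b lam W2 = loss n x b lam (W2 ** P) \<and>
        loss n x b lam (W2 ** P) = loss_sep n x b lam (W2 ** P)"
    if R: "rotation_matrix R" and P: "permutation_matrix P" for R P
  proof -
    obtain p where p: "p permutes UNIV" "P = perm_mat p"
      using P by (auto simp: permutation_matrix_def)
    have inj: "inj p"
      using p(1) by (rule permutes_inj)
    have "loss n x b lam (W1 ** R) = loss n x b lam W1"
      using R by (intro loss_cong gram_mult_orthogonal) (simp add: rotation_matrix_def)
    moreover have "loss n x b lam (W2 ** P) = loss n x b lam W2"
      unfolding p(2) by (intro loss_cong gram_mult_orthogonal orthogonal_perm_mat inj)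
    moreover have "loss n x b lam (W2 ** P) = loss_sep n x b lam (W2 ** P)"
      unfolding p(2) by (intro loss_eq_loss_sep lam orthogonal_columns_mult_perm_mat W2(2) inj)
    ultimately show ?thesis
      using eq W2(3) by simp
  qed
  have 2: "\<exists>M \<subseteq> {U ** S ** P | P. permutation_matrix P}.
             finite M \<and>
             real (card M) \<ge> fact CARD('k) / fact (CARD('k) - rank W2) \<and>
             (\<forall>A\<in>M. global_min (loss_sep n x b lam) A) \<and>
             (\<forall>A\<in>M. \<forall>B\<in>M. A \<noteq> B \<longrightarrow> disconnected (loss_sep n x b lam) A B)"
    if dist: "distinct_nonzero_eigenvalues (W2 ** transpose W2)" and svd: "is_svd W2 U S V" for U S V
  proof -
    define T where "T = U ** S"
    define M where "M = (\<lambda>p. T ** perm_mat p) ` {p. p permutes UNIV}"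
    have orthT: "orthogonal_columns T"
      unfolding T_def by (rule svd_orthogonal_columns[OF svd])
    \<comment> \<open>\<open>T\<close> and \<open>W2\<close> arise from each other by right
      multiplication, so their ranks agree.\<close>
    have "rank T \<le> rank W2"
      unfolding T_def svd_mult_eq[OF svd] by (rule rank_mul_le_left)
    moreover have "rank W2 \<le> rank T"
      using svd unfolding T_def is_svd_def by (metis rank_mul_le_left)
    ultimately have rankT: "nonzero_columns T = rank W2"
      using rank_orthogonal_columns[OF orthT] by simp
    have min: "global_min (loss_sep n x b lam) (T ** perm_mat p)" if "p permutes UNIV" for p
    proof -
      have "inj p"
        using that by (rule permutes_inj)
      then have "(T ** perm_mat p) ** transpose (T ** perm_mat p) = W2 ** transpose W2"
        using svd_gram[OF svd] by (simp add: gram_mult_orthogonal[OF orthogonal_perm_mat] T_def)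
      then have "loss_sep n x b lam (T ** perm_mat p) = loss_sep n x b lam W2"
        using orthogonal_columns_mult_perm_mat[OF orthT \<open>inj p\<close>]
        by (intro loss_sep_same_gram[OF lam n min2])
      then show ?thesis
        using min2 by (simp add: global_min_iff)
    qed
    have disc: "disconnected (loss_sep n x b lam) A B" if "A \<in> M" "B \<in> M" "A \<noteq> B" for A B
    proof -
      obtain p q where p: "p permutes UNIV" "A = T ** perm_mat p"
        and q: "q permutes UNIV" "B = T ** perm_mat q"
        using \<open>A \<in> M\<close> \<open>B \<in> M\<close> by (auto simp: M_def)
      have "\<exists>j. column j A \<noteq> column j B"
        using \<open>A \<noteq> B\<close> by (auto simp: column_def vec_eq_iff)
      then obtain j where j: "column (p j) T \<noteq> column (q j) T"
        by (auto simp: p q column_mult_perm_mat)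
      have "norm (column (p j) T) \<noteq> norm (column (q j) T)"
      proof
        assume eq: "norm (column (p j) T) = norm (column (q j) T)"
        \<comment> \<open>A zero column of equal norm would force the other column to be zero too,
          and the two would coincide.\<close>
        then have "column (p j) T \<noteq> 0"
          using j by auto
        then have "p j = q j"
          using eq unfolding T_def by (rule svd_distinct_column_norms[OF svd dist])
        then show False
          using j by simp
      qed
      then show ?thesis
        using min[OF p(1)] unfolding p(2) q(2)
        by (intro disconnected_minima[OF lam n, of x b _ j]) (simp_all add: column_mult_perm_mat)
    qed
    have "M \<subseteq> {U ** S ** P | P. permutation_matrix P}"
      by (auto simp: M_def T_def permutation_matrix_def)
    moreover have "finite M"
      by (simp add: M_def finite_permutations)
    moreover have "fact CARD('k) \<le> card M * fact (CARD('k) - rank W2)"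
      using card_column_permutations[OF orthogonal_columns_inj[OF orthT]] by (simp add: M_def rankT)
    then have "real (fact CARD('k)) \<le> real (card M * fact (CARD('k) - rank W2))"
      by (rule of_nat_mono)
    then have "fact CARD('k) / fact (CARD('k) - rank W2) \<le> real (card M)"
      by (simp add: field_simps)
    moreover have "\<forall>A\<in>M. global_min (loss_sep n x b lam) A"
      using min by (auto simp: M_def)
    ultimately show ?thesis
      using disc by blast
  qed
  have 3: "\<exists>W :: real^'k::{finite,linorder}^'d::{finite,linorder}. global_min (loss n x b lam) W \<and> nonzero_columns W = m"
    if m: "m \<in> {rank W2..CARD('k)}" "0 < rank W2 \<or> m = rank W2" for m
  proof (cases "m = rank W2")
    case True
    then show ?thesis
      using W2(1) rank by auto
  next
    case False
    then obtain X :: "real^'k::{finite,linorder}^'d::{finite,linorder}" where X: "X ** transpose X = W2 ** transpose W2" "nonzero_columns X = m"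
      using m by (auto simp: rank intro: ex_spread_columns[of W2 m])
    have "global_min (loss n x b lam) X"
      using W2(1) loss_cong[OF X(1), of n x b lam] by (simp add: global_min_iff)
    then show ?thesis
      using X(2) by blast
  qed
  show ?thesis
    using 1 2 3 ex_svd_orthogonal_columns[OF W2(2)] rank by auto
qed

end
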